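(* Let $k\geqslant r\geqslant 2$ be fixed integers. For each $N$ let $\mathcal{H}_N$ be a $k$-uniform hypergraph with vertex set $[N]$ which is $(r-1,\eta)$-near-regular (where $\eta=\eta_N\geqslant 0$) and has maximum $r$-degree $\Delta_r=\Delta_r(N)$, and write $h=e(\mathcal{H}_N)$. Let $p=p_N\in[0,1]$ be bounded away from $1$, and let $\delta_N$ be a sequence satisfying \[ \max\left\{\frac{\Delta_r (N\log N)^{r/2}}{p^{k-r/2}\,h},\ \big(\eta^{r}p^{k-r}\big)^{1/(r-1)},\ \frac{1}{\sqrt{pN}}\right\}\ll\delta_N\ll\left(\frac{p^{k-r}\,h}{N^r\Delta_r}\right)^{1/(r-1)}. \] Then, as $N\to\infty$, \[ \mathbb{P}\big(|D^{\mathcal{H}_N}(B_p)|>\delta_N L^{\mathcal{H}_N}(B_p)\big)=\exp\left(-(1+o(1))\frac{\delta_N^2\,pN}{2k^2(1-p)}\right). \]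
   Context: For a hypergraph $\mathcal{H}$ on $[N]$ and $S\subseteq[N]$, $d(S)$ is the number of edges containing $S$; the maximum $r$-degree $\Delta_r$ is the maximum of $d(S)$ over $r$-sets $S$; the average $r$-degree is $\bar d_r=e(\mathcal{H})\binom{k}{r}/\binom{N}{r}$; $\mathcal{H}$ is $(r,\eta)$-near-regular if every $r$-set $S$ has $d(S)\in[(1-\eta)\bar d_r,(1+\eta)\bar d_r]$. $B_p$ is the random subset of $[N]$ containing each element independently with probability $p$. $L^{\mathcal{H}}(B_p)=\mathbb{E}[e(\mathcal{H}[B_p])]=p^k e(\mathcal{H})$ and $D^{\mathcal{H}}(B_p)=e(\mathcal{H}[B_p])-p^ke(\mathcal{H})$, where $e(\mathcal{H}[B])$ is the number of edges contained in $B$. For sequences, $a_N\ll b_N$ means $a_N/b_N\to 0$ as $N\to\infty$. *)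

theory Defs
  imports "HOL-Probability.Probability" "HOL-Probability.Product_PMF"
begin

text \<open>
  A hypergraph on the vertex set \<open>[N] = {1..N}\<close> is given by its set of edges.
\<close>

definition uniform_hypergraph :: "nat \<Rightarrow> nat \<Rightarrow> nat set set \<Rightarrow> bool" where
  "uniform_hypergraph k N H \<longleftrightarrow> (\<forall>e\<in>H. e \<subseteq> {1..N} \<and> card e = k)"

definition hdegree :: "nat set set \<Rightarrow> nat set \<Rightarrow> nat" where
  "hdegree H S = card {e \<in> H. S \<subseteq> e}"

text \<open>For \<open>N < r\<close> there are no \<open>r\<close>-sets and the value of \<open>max_degree\<close> is unspecified.\<close>

definition max_degree :: "nat \<Rightarrow> nat \<Rightarrow> nat set set \<Rightarrow> nat" where
  "max_degree r N H = Max (hdegree H ` {S. S \<subseteq> {1..N} \<and> card S = r})"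

definition avg_degree :: "nat \<Rightarrow> nat \<Rightarrow> nat \<Rightarrow> nat set set \<Rightarrow> real" where
  "avg_degree k r N H = real (card H) * real (k choose r) / real (N choose r)"

definition near_regular :: "nat \<Rightarrow> nat \<Rightarrow> real \<Rightarrow> nat \<Rightarrow> nat set set \<Rightarrow> bool" where
  "near_regular k r \<eta> N H \<longleftrightarrow>
     (\<forall>S. S \<subseteq> {1..N} \<and> card S = r \<longrightarrow>
        real (hdegree H S) \<in> {(1 - \<eta>) * avg_degree k r N H .. (1 + \<eta>) * avg_degree k r N H})"

definition edges_in :: "nat set set \<Rightarrow> nat set \<Rightarrow> nat" where
  "edges_in H B = card {e \<in> H. e \<subseteq> B}"

definition random_subset :: "nat \<Rightarrow> real \<Rightarrow> nat set pmf" where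
  "random_subset N p =
     map_pmf (\<lambda>f. {i \<in> {1..N}. f i}) (Pi_pmf {1..N} False (\<lambda>_. bernoulli_pmf p))"

definition expected_edges :: "nat \<Rightarrow> nat set set \<Rightarrow> real \<Rightarrow> real" where
  "expected_edges N H p =
     measure_pmf.expectation (random_subset N p) (\<lambda>B. real (edges_in H B))"

definition deviation :: "nat \<Rightarrow> nat set set \<Rightarrow> real \<Rightarrow> nat set \<Rightarrow> real" where
  "deviation k H p B = real (edges_in H B) - p ^ k * real (card H)"

text \<open>
  This is only meaningful for eventually nonzero \<open>b\<close>, because \<open>a / 0 = 0\<close>.
\<close>

definition much_less :: "(nat \<Rightarrow> real) \<Rightarrow> (nat \<Rightarrow> real) \<Rightarrow> bool" (infix "\<lless>" 50) where
  "a \<lless> b \<longleftrightarrow> (\<lambda>N. a N / b N) \<longlonglongrightarrow> 0"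

lemma prob_subset_random_subset:
  assumes "e \<subseteq> {1..N}" "0 \<le> p" "p \<le> 1"
  shows "measure_pmf.prob (random_subset N p) {B. e \<subseteq> B} = p ^ card e"
proof -
  let ?A = "\<lambda>i. if i \<in> e then {True} else UNIV"
  have "measure_pmf.prob (random_subset N p) {B. e \<subseteq> B} =
        measure_pmf.prob (Pi_pmf {1..N} False (\<lambda>_. bernoulli_pmf p)) (Pi {1..N} ?A)"
    unfolding random_subset_def measure_map_pmf
    by (rule arg_cong[where f = "measure_pmf.prob _"]) (use assms(1) in \<open>auto simp: Pi_def subset_iff\<close>)
  also have "\<dots> = (\<Prod>i\<in>{1..N}. measure_pmf.prob (bernoulli_pmf p) (?A i))"
    by (subst measure_Pi_pmf_Pi) auto
  also have "\<dots> = (\<Prod>i\<in>{1..N}. if i \<in> e then p else 1)"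
    using assms by (intro prod.cong) (auto simp: measure_pmf_single)
  also have "\<dots> = p ^ card e"
    using assms(1) by (subst prod.If_cases) (auto simp: Int_absorb1 Int_absorb2)
  finally show ?thesis .
qed

lemma expected_edges_eq:
  assumes "uniform_hypergraph k N H" "0 \<le> p" "p \<le> 1"
  shows "expected_edges N H p = p ^ k * real (card H)"
proof -
  have "finite H"
    by (rule finite_subset[of _ "Pow {1..N}"])
      (use assms(1) in \<open>auto simp: uniform_hypergraph_def\<close>)
  then have "(\<lambda>B. real (edges_in H B)) = (\<lambda>B. \<Sum>e\<in>H. indicat_real {B. e \<subseteq> B} B)"
    by (auto simp: edges_in_def indicator_def sum.If_cases Int_def fun_eq_iff)
  then have "expected_edges N H p =
      (\<Sum>e\<in>H. measure_pmf.prob (random_subset N p) {B. e \<subseteq> B})"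
    unfolding expected_edges_def
    by (simp only:) (subst Bochner_Integration.integral_sum,
      auto simp: measure_pmf.emeasure_eq_measure)
  also have "\<dots> = (\<Sum>e\<in>H. p ^ k)"
    using assms by (intro sum.cong) (auto simp: uniform_hypergraph_def prob_subset_random_subset)
  finally show ?thesis by simp
qed

end

theory Submission
  imports Defs
begin

text \<open>
  Put \<open>Y\<^sub>i = 1[i \<in> B] - p\<close> and \<open>Y\<^sub>S = (\<Prod>i\<in>S. Y\<^sub>i)\<close>. Expanding each edge indicator in the \<open>Y\<^sub>i\<close> from its
  largest vertex downwards and stopping after \<open>r\<close> factors gives
  \<open>D = (\<Sum>1\<le>j<r. p ^ (k - j) * (\<Sum>|S|=j. d(S) Y\<^sub>S)) + (\<Sum>|S|=r. G\<^sub>S Y\<^sub>S)\<close>,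
  where \<open>0 \<le> G\<^sub>S \<le> \<Delta>\<^sub>r\<close> depends only on the part of \<open>B\<close> below \<open>S\<close>. Replacing \<open>d(S)\<close> by the average
  degree turns the term \<open>j = 1\<close> into \<open>k L (|B| - p N) / (p N)\<close>, which carries the deviation, and the
  terms \<open>2 \<le> j < r\<close> into elementary symmetric polynomials of the \<open>Y\<^sub>i\<close>, which are functions of \<open>|B|\<close>
  and of order \<open>\<delta> ^ j L\<close>. The errors \<open>(d(S) - avg) Y\<^sub>S\<close> and \<open>G\<^sub>S Y\<^sub>S\<close> are iterated martingales:
  with \<open>t = K \<delta>\<^sup>2 p N + r log N\<close> an order-\<open>j\<close> chaos with coefficients bounded by \<open>b\<close> exceeds
  \<open>b (4 p N t) ^ (j/2)\<close> with probability \<open>O(exp (- K \<delta>\<^sup>2 p N))\<close>, the logarithm paying for union bounds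
  over subsets. The hypotheses on \<open>\<delta>\<close> say that all these errors are \<open>o(\<delta> L)\<close>, so that the moderate
  deviations of the binomial variable \<open>|B|\<close> decide.
\<close>

section \<open>Expectations over a random subset\<close>

text \<open>Vertices are revealed in the order 1, ..., N, so a sum of terms
  \<open>cbit p i B * Z i B\<close> is a martingale as soon as \<open>Z i\<close> sees only the part
  of \<open>B\<close> below \<open>i\<close>. This is why edges are expanded from the largest
  vertex: the unexpanded vertices must lie below the chosen ones. Error terms may lose constant
  factors in the exponent; only the law of |B| must be sharp there. The elementary symmetric
  polynomials of orders 2 to r - 1 are the obstacle. With x = sqrt (log N / (p N)), the chaos
  estimate bounds them by powers of \<delta> + x, and x^2 need not be o(\<delta>). They are
  therefore bounded deterministically, by the Krawtchouk recurrence, on the event that |B| - p N is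
  O(\<delta> p N); that event costs no logarithm. The other errors carry a factor \<eta> or 1/Q with
  Q = p^(k-r) h / (N^r \<Delta>), and the hypotheses give \<eta> x = o(\<delta>) and x^r / Q =
  o(\<delta>). The constant K stays free until the end, where it makes the exceptional events O(exp
  (-2 X)) against a main term exp (-(1 + o(1)) X), X being the claimed exponent.\<close>

lemma set_pmf_random_subset: "set_pmf (random_subset N p) \<subseteq> Pow {1..N}"
  by (auto simp: random_subset_def)

lemma finite_set_pmf_random_subset [simp]: "finite (set_pmf (random_subset N p))"
  using finite_subset[OF set_pmf_random_subset] by simp

lemma integrable_random_subset [simp]:
  fixes f :: "nat set \<Rightarrow> real"
  shows "integrable (measure_pmf (random_subset N p)) f"
  by (rule integrable_measure_pmf_finite) simp

lemma random_subset_0: "random_subset 0 p = return_pmf {}"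
  by (simp add: random_subset_def)

lemma random_subset_Suc:
  "random_subset (Suc N) p = bernoulli_pmf p \<bind>
     (\<lambda>x. map_pmf (\<lambda>B. if x then insert (Suc N) B else B) (random_subset N p))"
proof -
  have ins: "{1..Suc N} = insert (Suc N) {1..N}" by auto
  have "random_subset (Suc N) p = bernoulli_pmf p \<bind>
     (\<lambda>x. map_pmf (\<lambda>f. {i \<in> {1..Suc N}. (f(Suc N := x)) i})
        (Pi_pmf {1..N} False (\<lambda>_. bernoulli_pmf p)))"
    unfolding random_subset_def ins
    by (subst Pi_pmf_insert') (auto simp: map_bind_pmf map_pmf_def bind_assoc_pmf bind_return_pmf)
  also have "(\<lambda>x f. {i \<in> {1..Suc N}. (f(Suc N := x)) i}) =
      (\<lambda>x f. if x then insert (Suc N) {i \<in> {1..N}. f i} else {i \<in> {1..N}. f i})"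
    by (auto simp: fun_eq_iff split: if_splits)
  finally show ?thesis
    by (simp add: random_subset_def[of N] pmf.map_comp o_def del: mem_Collect_eq cong: if_cong)
qed

text \<open>Averages over the last vertex given all earlier ones. The exponential moments below are
  computed by induction on \<open>N\<close> through this identity.\<close>

lemma expectation_random_subset_Suc:
  fixes f :: "nat set \<Rightarrow> real"
  assumes "0 \<le> p" "p \<le> 1"
  shows "measure_pmf.expectation (random_subset (Suc N) p) f =
    measure_pmf.expectation (random_subset N p) (\<lambda>B. p * f (insert (Suc N) B) + (1 - p) * f B)"
proof -
  have "measure_pmf.expectation (random_subset (Suc N) p) f =
    (\<Sum>x\<in>UNIV. pmf (bernoulli_pmf p) x *\<^sub>R measure_pmf.expectation
       (map_pmf (\<lambda>B. if x then insert (Suc N) B else B) (random_subset N p)) f)"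
    unfolding random_subset_Suc by (rule pmf_expectation_bind) auto
  also have "\<dots> = p * measure_pmf.expectation (random_subset N p) (\<lambda>B. f (insert (Suc N) B))
      + (1 - p) * measure_pmf.expectation (random_subset N p) f"
    using assms by (simp add: UNIV_bool)
  finally show ?thesis by simp
qed

lemma expectation_random_subset_mono:
  fixes f g :: "nat set \<Rightarrow> real"
  assumes "\<And>B. B \<subseteq> {1..N} \<Longrightarrow> f B \<le> g B"
  shows "measure_pmf.expectation (random_subset N p) f \<le> measure_pmf.expectation (random_subset N p) g"
  using assms set_pmf_random_subset[of N p]
  by (intro integral_mono_AE) (auto simp: AE_measure_pmf_iff)

lemma expectation_random_subset_cong:
  fixes f g :: "nat set \<Rightarrow> real"
  assumes "\<And>B. B \<subseteq> {1..N} \<Longrightarrow> f B = g B"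
  shows "measure_pmf.expectation (random_subset N p) f = measure_pmf.expectation (random_subset N p) g"
  using assms by (intro antisym expectation_random_subset_mono) auto

lemma prob_random_subset_mono:
  assumes "\<And>B. B \<subseteq> {1..N} \<Longrightarrow> B \<in> A \<Longrightarrow> B \<in> A'"
  shows "measure_pmf.prob (random_subset N p) A \<le> measure_pmf.prob (random_subset N p) A'"
  using assms set_pmf_random_subset[of N p]
  by (intro measure_pmf.finite_measure_mono_AE) (auto simp: AE_measure_pmf_iff)

lemma prob_eq_expectation_indicator:
  "measure_pmf.prob M A = measure_pmf.expectation M (indicat_real A)"
  by (simp add: measure_pmf.emeasure_eq_measure)

lemma prob_random_subset_exp_bound:
  "measure_pmf.prob (random_subset N p) {B. f B > s}
     \<le> exp (- s) * measure_pmf.expectation (random_subset N p) (\<lambda>B. exp (f B))"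
proof -
  have "measure_pmf.prob (random_subset N p) {B. f B > s}
     \<le> measure_pmf.expectation (random_subset N p) (\<lambda>B. exp (- s) * exp (f B))"
    unfolding prob_eq_expectation_indicator
    by (rule expectation_random_subset_mono) (auto simp: indicator_def mult_exp_exp)
  then show ?thesis by simp
qed

section \<open>Moment generating functions of centred bits\<close>

lemma exp_taylor2:
  fixes x :: real
  assumes "\<bar>x\<bar> \<le> 1"
  shows "\<bar>exp x - (1 + x + x\<^sup>2 / 2)\<bar> \<le> \<bar>x\<bar> ^ 3 / 2"
proof -
  obtain t where t: "\<bar>t\<bar> \<le> \<bar>x\<bar>" "exp x = (\<Sum>m<3. x ^ m / fact m) + exp t / fact 3 * x ^ 3"
    using Maclaurin_exp_le[of x 3] by blast
  have "exp t \<le> exp 1" using t(1) assms by simp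
  then have e: "exp t \<le> 3" using exp_le by linarith
  have "exp x - (1 + x + x\<^sup>2 / 2) = exp t / 6 * x ^ 3"
    using t(2) by (simp add: numeral_3_eq_3 lessThan_Suc power2_eq_square fact_numeral)
  then have "\<bar>exp x - (1 + x + x\<^sup>2 / 2)\<bar> = exp t / 6 * \<bar>x\<bar> ^ 3"
    by (simp only: abs_mult power_abs) simp
  also have "\<dots> \<le> 3 / 6 * \<bar>x\<bar> ^ 3"
    using e by (intro mult_right_mono) auto
  finally show ?thesis by simp
qed

definition cbit :: "real \<Rightarrow> nat \<Rightarrow> nat set \<Rightarrow> real" where
  "cbit p i B = of_bool (i \<in> B) - p"

text \<open>The linear terms cancel because the bit is centred, the quadratic ones give the
  variance, and the cubic ones add up to \<open>p * (1 - p) * ((1 - p)\<^sup>2 + p\<^sup>2)\<close>.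
  Hence the error keeps the factor \<open>p * (1 - p)\<close> and is small relative to the variance
  even when \<open>p\<close> tends to 0.\<close>

lemma mgf_bernoulli_taylor:
  fixes p u :: real
  assumes "0 \<le> p" "p \<le> 1" "\<bar>u\<bar> \<le> 1"
  shows "\<bar>p * exp (u * (1 - p)) + (1 - p) * exp (- (u * p)) - (1 + u\<^sup>2 * (p * (1 - p)) / 2)\<bar>
           \<le> u\<^sup>2 * (p * (1 - p)) / 2 * \<bar>u\<bar>"
proof -
  define a b where "a = u * (1 - p)" and "b = - (u * p)"
  have ab: "\<bar>a\<bar> = \<bar>u\<bar> * (1 - p)" "\<bar>b\<bar> = \<bar>u\<bar> * p"
    using assms by (auto simp: a_def b_def abs_mult)
  have a1: "\<bar>a\<bar> \<le> 1" "\<bar>b\<bar> \<le> 1"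
    unfolding ab using assms by (auto intro: mult_le_one)
  have id: "p * exp a + (1 - p) * exp b - (1 + u\<^sup>2 * (p * (1 - p)) / 2) =
      p * (exp a - (1 + a + a\<^sup>2 / 2)) + (1 - p) * (exp b - (1 + b + b\<^sup>2 / 2))"
    by (simp add: a_def b_def field_simps power2_eq_square)
  have "\<bar>p * exp a + (1 - p) * exp b - (1 + u\<^sup>2 * (p * (1 - p)) / 2)\<bar>
      \<le> p * \<bar>exp a - (1 + a + a\<^sup>2 / 2)\<bar> + (1 - p) * \<bar>exp b - (1 + b + b\<^sup>2 / 2)\<bar>"
    unfolding id using assms by (intro order.trans[OF abs_triangle_ineq]) (simp add: abs_mult)
  also have "\<dots> \<le> p * (\<bar>a\<bar> ^ 3 / 2) + (1 - p) * (\<bar>b\<bar> ^ 3 / 2)"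
    using assms a1 by (intro add_mono mult_left_mono exp_taylor2) auto
  also have "\<dots> = u\<^sup>2 * (p * (1 - p)) / 2 * \<bar>u\<bar> * ((1 - p)\<^sup>2 + p\<^sup>2)"
    unfolding ab power2_abs[of u, symmetric] by (simp add: field_simps power2_eq_square power3_eq_cube del: abs_mult_self_eq)
  also have "\<dots> \<le> u\<^sup>2 * (p * (1 - p)) / 2 * \<bar>u\<bar> * 1"
  proof (rule mult_left_mono)
    have "(1 - p)\<^sup>2 + p\<^sup>2 = 1 - 2 * (p * (1 - p))"
      by (simp add: power2_eq_square algebra_simps)
    then show "(1 - p)\<^sup>2 + p\<^sup>2 \<le> 1" using assms by simp
  qed (use assms in auto)
  finally show ?thesis by (simp add: a_def b_def)
qed

lemma mgf_bernoulli_le: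
  fixes p u :: real
  assumes "0 \<le> p" "p \<le> 1" "\<bar>u\<bar> \<le> 1"
  shows "p * exp (u * (1 - p)) + (1 - p) * exp (- (u * p)) \<le> exp (u\<^sup>2 * (p * (1 - p)) / 2 * (1 + \<bar>u\<bar>))"
proof -
  have "p * exp (u * (1 - p)) + (1 - p) * exp (- (u * p)) \<le> 1 + u\<^sup>2 * (p * (1 - p)) / 2 * (1 + \<bar>u\<bar>)"
    using mgf_bernoulli_taylor[OF assms] unfolding abs_le_iff ring_distribs by linarith
  also have "\<dots> \<le> exp (u\<^sup>2 * (p * (1 - p)) / 2 * (1 + \<bar>u\<bar>))"
    by (rule exp_ge_add_one_self)
  finally show ?thesis .
qed

text \<open>The Taylor bound leaves 1 + v with v = s (1 - |u|) and v \<le> |u|. Passing to the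
  exponential costs ln (1 + v) \<ge> v - v^2 \<ge> v (1 - |u|), a second factor 1 - |u|; the product
  of the two is at least 1 - 2 |u|.\<close>

lemma mgf_bernoulli_ge:
  fixes p u :: real
  assumes "0 \<le> p" "p \<le> 1" "\<bar>u\<bar> \<le> 1"
  shows "exp (u\<^sup>2 * (p * (1 - p)) / 2 * (1 - 2 * \<bar>u\<bar>)) \<le> p * exp (u * (1 - p)) + (1 - p) * exp (- (u * p))"
proof -
  define s where "s = u\<^sup>2 * (p * (1 - p)) / 2"
  define v where "v = s * (1 - \<bar>u\<bar>)"
  have pq: "0 \<le> p * (1 - p)" "p * (1 - p) \<le> 1"
    using assms mult_le_one[of p "1 - p"] by auto
  have s0: "0 \<le> s" using pq by (auto simp: s_def)
  have v0: "0 \<le> v" using s0 assms by (auto simp: v_def)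
  have u2: "u\<^sup>2 \<le> \<bar>u\<bar>" using assms(3) mult_left_le[of "\<bar>u\<bar>" "\<bar>u\<bar>"] by (simp add: power2_eq_square)
  have "u\<^sup>2 * (p * (1 - p)) \<le> u\<^sup>2 * 1" using pq by (intro mult_left_mono) auto
  then have su: "s \<le> \<bar>u\<bar>" unfolding s_def using u2 by (simp add: field_simps)
  have "v \<le> s" unfolding v_def using s0 by (simp add: mult_left_le)
  then have vu: "v \<le> \<bar>u\<bar>" using su by linarith
  then have v1: "v \<le> 1" using assms by linarith
  have "s * (1 - 2 * \<bar>u\<bar>) \<le> s * ((1 - \<bar>u\<bar>) * (1 - \<bar>u\<bar>))"
    using s0 by (intro mult_left_mono) (auto simp: algebra_simps)
  also have "\<dots> = v * (1 - \<bar>u\<bar>)" by (simp add: v_def)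
  also have "\<dots> \<le> v * (1 - v)" using v0 vu by (intro mult_left_mono) auto
  also have "\<dots> = v - v\<^sup>2" by (simp add: power2_eq_square algebra_simps)
  also have "\<dots> \<le> ln (1 + v)" using v0 v1 by (rule ln_one_plus_pos_lower_bound)
  finally have "exp (s * (1 - 2 * \<bar>u\<bar>)) \<le> exp (ln (1 + v))" by simp
  also have "\<dots> = 1 + v" using v0 by simp
  also have "\<dots> \<le> p * exp (u * (1 - p)) + (1 - p) * exp (- (u * p))"
    using mgf_bernoulli_taylor[OF assms] unfolding v_def s_def abs_le_iff ring_distribs by linarith
  finally show ?thesis by (simp add: s_def)
qed

text \<open>For \<open>B\<close> inside \<open>{1..N}\<close> this is \<open>card B - p * N\<close>,
  the centred binomial variable that decides the asymptotics.\<close>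

definition csum :: "nat \<Rightarrow> real \<Rightarrow> nat set \<Rightarrow> real" where
  "csum N p B = (\<Sum>i=1..N. cbit p i B)"

lemma mgf_csum:
  assumes "0 \<le> p" "p \<le> 1"
  shows "measure_pmf.expectation (random_subset N p) (\<lambda>B. exp (u * csum N p B))
      = (p * exp (u * (1 - p)) + (1 - p) * exp (- (u * p))) ^ N"
proof (induction N)
  case 0
  then show ?case by (simp add: random_subset_0 csum_def)
next
  case (Suc N)
  have "measure_pmf.expectation (random_subset (Suc N) p) (\<lambda>B. exp (u * csum (Suc N) p B)) =
     measure_pmf.expectation (random_subset N p)
       (\<lambda>B. p * exp (u * csum (Suc N) p (insert (Suc N) B)) + (1 - p) * exp (u * csum (Suc N) p B))"
    by (rule expectation_random_subset_Suc[OF assms])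
  also have "\<dots> = measure_pmf.expectation (random_subset N p)
       (\<lambda>B. (p * exp (u * (1 - p)) + (1 - p) * exp (- (u * p))) * exp (u * csum N p B))"
  proof (rule expectation_random_subset_cong)
    fix B assume B: "B \<subseteq> {1..N}"
    have "csum (Suc N) p (insert (Suc N) B) = csum N p B + (1 - p)"
      unfolding csum_def by (simp add: cbit_def)
    moreover have "csum (Suc N) p B = csum N p B - p"
      using B by (auto simp: csum_def cbit_def)
    ultimately have "exp (u * csum (Suc N) p (insert (Suc N) B)) = exp (u * (1 - p)) * exp (u * csum N p B)"
      "exp (u * csum (Suc N) p B) = exp (- (u * p)) * exp (u * csum N p B)"
      by (simp_all add: mult_exp_exp ring_distribs)
    then show "p * exp (u * csum (Suc N) p (insert (Suc N) B)) + (1 - p) * exp (u * csum (Suc N) p B)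
       = (p * exp (u * (1 - p)) + (1 - p) * exp (- (u * p))) * exp (u * csum N p B)"
      by (simp only: ring_distribs mult.assoc)
  qed
  finally show ?case using Suc.IH by simp
qed

lemma mgf_csum_le:
  assumes "0 \<le> p" "p \<le> 1" "\<bar>u\<bar> \<le> 1"
  shows "measure_pmf.expectation (random_subset N p) (\<lambda>B. exp (u * csum N p B))
     \<le> exp (u\<^sup>2 * (real N * (p * (1 - p))) / 2 * (1 + \<bar>u\<bar>))"
proof -
  have "(p * exp (u * (1 - p)) + (1 - p) * exp (- (u * p))) ^ N
      \<le> exp (u\<^sup>2 * (p * (1 - p)) / 2 * (1 + \<bar>u\<bar>)) ^ N"
    using assms by (intro power_mono mgf_bernoulli_le) auto
  then show ?thesis
    unfolding mgf_csum[OF assms(1,2)] exp_of_nat_mult[symmetric] by (simp add: mult_ac)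
qed

lemma mgf_csum_ge:
  assumes "0 \<le> p" "p \<le> 1" "\<bar>u\<bar> \<le> 1"
  shows "exp (u\<^sup>2 * (real N * (p * (1 - p))) / 2 * (1 - 2 * \<bar>u\<bar>))
    \<le> measure_pmf.expectation (random_subset N p) (\<lambda>B. exp (u * csum N p B))"
proof -
  have "exp (u\<^sup>2 * (p * (1 - p)) / 2 * (1 - 2 * \<bar>u\<bar>)) ^ N
      \<le> (p * exp (u * (1 - p)) + (1 - p) * exp (- (u * p))) ^ N"
    using assms by (intro power_mono mgf_bernoulli_ge) auto
  then show ?thesis
    unfolding mgf_csum[OF assms(1,2)] exp_of_nat_mult[symmetric] by (simp add: mult_ac)
qed

text \<open>Given the part of \<open>B\<close> below the last index, the last \<open>Z\<close> is
  frozen and \<open>mgf_bernoulli_le\<close> applies to a single bit. The constant in the exponent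
  is not sharp, which is harmless because only error terms and crude size bounds are controlled this
  way.\<close>

lemma mgf_adapted_sum_le:
  assumes p: "0 \<le> p" "p \<le> 1"
    and Zb: "\<And>i B. i \<in> {1..N} \<Longrightarrow> \<bar>Z i B\<bar> \<le> b"
    and ad: "\<And>i B. i \<in> {1..N} \<Longrightarrow> Z i B = Z i (B \<inter> {..<i})"
    and u: "\<bar>u\<bar> * b \<le> 1"
  shows "measure_pmf.expectation (random_subset N p) (\<lambda>B. exp (u * (\<Sum>i=1..N. cbit p i B * Z i B)))
      \<le> exp (real N * (u\<^sup>2 * b\<^sup>2 * p))"
  using Zb ad
proof (induction N)
  case 0
  show ?case by (simp add: random_subset_0)
next
  case (Suc N)
  define S where "S B = (\<Sum>i=1..N. cbit p i B * Z i B)" for B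
  have S: "(\<Sum>i=1..Suc N. cbit p i B * Z i B) = S B + cbit p (Suc N) B * Z (Suc N) B" for B
    by (simp add: S_def)
  let ?m = "exp (u\<^sup>2 * b\<^sup>2 * p)"
  have "measure_pmf.expectation (random_subset (Suc N) p) (\<lambda>B. exp (u * (\<Sum>i=1..Suc N. cbit p i B * Z i B))) =
     measure_pmf.expectation (random_subset N p)
       (\<lambda>B. p * exp (u * (S (insert (Suc N) B) + cbit p (Suc N) (insert (Suc N) B) * Z (Suc N) (insert (Suc N) B)))
          + (1 - p) * exp (u * (S B + cbit p (Suc N) B * Z (Suc N) B)))"
    unfolding S by (rule expectation_random_subset_Suc[OF p])
  also have "\<dots> \<le> measure_pmf.expectation (random_subset N p) (\<lambda>B. ?m * exp (u * S B))"
  proof (rule expectation_random_subset_mono)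
    fix B assume B: "B \<subseteq> {1..N}"
    have S1: "S (insert (Suc N) B) = S B"
      unfolding S_def
    proof (rule sum.cong[OF refl])
      fix i assume i: "i \<in> {1..N}"
      have "insert (Suc N) B \<inter> {..<i} = B \<inter> {..<i}" using i by auto
      moreover have "i \<in> {1..Suc N}" using i by auto
      ultimately have "Z i (insert (Suc N) B) = Z i B"
        using Suc.prems(2) by metis
      then show "cbit p i (insert (Suc N) B) * Z i (insert (Suc N) B) = cbit p i B * Z i B"
        using i by (auto simp: cbit_def)
    qed
    have "insert (Suc N) B \<inter> {..<Suc N} = B \<inter> {..<Suc N}" by auto
    then have Z1: "Z (Suc N) (insert (Suc N) B) = Z (Suc N) B"
      using Suc.prems(2) by (metis atLeastAtMost_iff le_add1 order_refl plus_1_eq_Suc)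
    define z where "z = u * Z (Suc N) B"
    have zb: "\<bar>z\<bar> \<le> \<bar>u\<bar> * b"
      unfolding z_def abs_mult using Suc.prems(1)[of "Suc N" B] by (intro mult_left_mono) auto
    then have z1: "\<bar>z\<bar> \<le> 1" using u by linarith
    have z2: "z\<^sup>2 \<le> u\<^sup>2 * b\<^sup>2"
      using power_mono[OF zb, of 2] by (simp add: power_mult_distrib)
    have pq: "0 \<le> p * (1 - p)" "p * (1 - p) \<le> p" using p by (auto simp: mult_left_le)
    have "z\<^sup>2 * (p * (1 - p)) / 2 * (1 + \<bar>z\<bar>) \<le> z\<^sup>2 * (p * (1 - p)) / 2 * 2"
      using pq z1 by (intro mult_left_mono) auto
    also have "\<dots> \<le> u\<^sup>2 * b\<^sup>2 * p"
      using pq z2 by (simp, intro mult_mono) auto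
    finally have e: "z\<^sup>2 * (p * (1 - p)) / 2 * (1 + \<bar>z\<bar>) \<le> u\<^sup>2 * b\<^sup>2 * p" .
    have c: "cbit p (Suc N) (insert (Suc N) B) = 1 - p" "cbit p (Suc N) B = - p"
      using B by (auto simp: cbit_def)
    have "exp (u * (S B + (1 - p) * Z (Suc N) B)) = exp (z * (1 - p)) * exp (u * S B)"
      "exp (u * (S B + - p * Z (Suc N) B)) = exp (- (z * p)) * exp (u * S B)"
      by (simp_all add: mult_exp_exp ring_distribs z_def mult_ac)
    then have "p * exp (u * (S (insert (Suc N) B) + cbit p (Suc N) (insert (Suc N) B) * Z (Suc N) (insert (Suc N) B)))
          + (1 - p) * exp (u * (S B + cbit p (Suc N) B * Z (Suc N) B))
       = (p * exp (z * (1 - p)) + (1 - p) * exp (- (z * p))) * exp (u * S B)"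
      unfolding S1 Z1 c by (simp only: ring_distribs mult.assoc)
    also have "\<dots> \<le> ?m * exp (u * S B)"
      using order.trans[OF mgf_bernoulli_le[OF p z1]] e by (intro mult_right_mono) auto
    finally show "p * exp (u * (S (insert (Suc N) B) + cbit p (Suc N) (insert (Suc N) B) * Z (Suc N) (insert (Suc N) B)))
          + (1 - p) * exp (u * (S B + cbit p (Suc N) B * Z (Suc N) B)) \<le> ?m * exp (u * S B)" .
  qed
  also have "\<dots> = ?m * measure_pmf.expectation (random_subset N p) (\<lambda>B. exp (u * S B))" by simp
  also have "\<dots> \<le> ?m * exp (real N * (u\<^sup>2 * b\<^sup>2 * p))"
    unfolding S_def by (intro mult_left_mono Suc.IH Suc.prems) auto
  also have "\<dots> = exp (real (Suc N) * (u\<^sup>2 * b\<^sup>2 * p))"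
    by (simp add: mult_exp_exp algebra_simps)
  finally show ?case .
qed

lemma adapted_sum_tail_bounded:
  assumes p: "0 \<le> p" "p \<le> 1"
    and Zb: "\<And>i B. i \<in> {1..N} \<Longrightarrow> \<bar>Z i B\<bar> \<le> b"
    and ad: "\<And>i B. i \<in> {1..N} \<Longrightarrow> Z i B = Z i (B \<inter> {..<i})"
    and b: "0 \<le> b" and t: "0 \<le> t" "t \<le> p * real N"
  shows "measure_pmf.prob (random_subset N p)
      {B. \<bar>\<Sum>i=1..N. cbit p i B * Z i B\<bar> > b * (2 * sqrt (p * real N * t))} \<le> 2 * exp (- t)"
proof -
  define M where "M B = (\<Sum>i=1..N. cbit p i B * Z i B)" for B
  define s where "s = b * (2 * sqrt (p * real N * t))"
  \<comment> \<open>The tilt chosen below must be positive and divides by \<open>b\<close>. For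
    \<open>t = 0\<close> the claimed bound is 2, and for \<open>b = 0\<close> every
    \<open>Z i\<close> vanishes.\<close>
  consider "t = 0" | "b = 0" | "t > 0" "b > 0" using b t by linarith
  then show ?thesis
  proof cases
    case 1
    then show ?thesis by (simp add: order.trans[OF measure_pmf.prob_le_1])
  next
    case 2
    have "Z i B = 0" if "i \<in> {1..N}" for i B using Zb[OF that, of B] 2 by simp
    then have "(\<Sum>i=1..N. cbit p i B * Z i B) = 0" for B by simp
    then show ?thesis using 2 by simp
  next
    case 3
    then have v: "p * real N > 0" using t by linarith
    then have pN: "p \<noteq> 0" "N \<noteq> 0" by (auto intro: gr0I)
    \<comment> \<open>This tilt makes the exponential moment cost \<open>exp t\<close> while the
      threshold gains \<open>exp (- 2 * t)\<close>. The assumption \<open>t \<le> p * real N\<close>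
      becomes \<open>u * b \<le> 1\<close>.\<close>
    define u where "u = sqrt (t / (p * real N)) / b"
    have u0: "u > 0" unfolding u_def using v 3 by simp
    have u1: "\<bar>u\<bar> * b \<le> 1" "\<bar>-u\<bar> * b \<le> 1" using v 3 t u0 by (simp_all add: u_def)
    have us: "u * s = 2 * t"
    proof -
      have "sqrt (t / (p * real N)) * sqrt (p * real N * t) = sqrt (t * t)"
        using v by (subst real_sqrt_mult[symmetric]) auto
      then show ?thesis using 3 by (simp add: u_def s_def)
    qed
    have ub: "real N * (u\<^sup>2 * b\<^sup>2 * p) = t" "real N * ((-u)\<^sup>2 * b\<^sup>2 * p) = t"
      using v 3 pN by (simp_all add: u_def power_divide)
    have *: "measure_pmf.prob (random_subset N p) {B. w * M B > 2 * t} \<le> exp (- t)"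
      if w: "\<bar>w\<bar> * b \<le> 1" "real N * (w\<^sup>2 * b\<^sup>2 * p) = t" for w
    proof -
      have "measure_pmf.prob (random_subset N p) {B. w * M B > 2 * t}
         \<le> exp (- (2 * t)) * measure_pmf.expectation (random_subset N p) (\<lambda>B. exp (w * M B))"
        by (rule prob_random_subset_exp_bound)
      also have "\<dots> \<le> exp (- (2 * t)) * exp (real N * (w\<^sup>2 * b\<^sup>2 * p))"
        unfolding M_def by (intro mult_left_mono mgf_adapted_sum_le p Zb ad w) auto
      also have "\<dots> = exp (- t)" unfolding w(2) by (simp add: mult_exp_exp)
      finally show ?thesis .
    qed
    have "measure_pmf.prob (random_subset N p) {B. \<bar>M B\<bar> > s}
       \<le> measure_pmf.prob (random_subset N p) ({B. u * M B > 2 * t} \<union> {B. (-u) * M B > 2 * t})"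
    proof (rule prob_random_subset_mono)
      fix B assume "B \<in> {B. \<bar>M B\<bar> > s}"
      then have "M B > s \<or> - M B > s" by auto
      then have "u * M B > u * s \<or> u * (- M B) > u * s" using u0 by (metis mult_less_cancel_left_pos)
      then show "B \<in> {B. u * M B > 2 * t} \<union> {B. (-u) * M B > 2 * t}" using us by auto
    qed
    also have "\<dots> \<le> measure_pmf.prob (random_subset N p) {B. u * M B > 2 * t}
        + measure_pmf.prob (random_subset N p) {B. (-u) * M B > 2 * t}"
      by (rule measure_Un_le) auto
    also have "\<dots> \<le> exp (- t) + exp (- t)"
      using u1 ub by (intro add_mono *) auto
    finally show ?thesis by (simp add: M_def s_def)
  qed
qed

text \<open>Setting \<open>Z i\<close> to 0 where it exceeds \<open>b\<close> keeps it adapted and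
  changes the sum only on the union of the exceptional events, whose probabilities are
  added.\<close>

lemma adapted_sum_tail:
  assumes p: "0 \<le> p" "p \<le> 1"
    and ad: "\<And>i B. i \<in> {1..N} \<Longrightarrow> Z i B = Z i (B \<inter> {..<i})"
    and b: "0 \<le> b" and t: "0 \<le> t" "t \<le> p * real N"
  shows "measure_pmf.prob (random_subset N p)
      {B. \<bar>\<Sum>i=1..N. cbit p i B * Z i B\<bar> > b * (2 * sqrt (p * real N * t))}
     \<le> 2 * exp (- t) + (\<Sum>i=1..N. measure_pmf.prob (random_subset N p) {B. \<bar>Z i B\<bar> > b})"
proof -
  let ?P = "measure_pmf.prob (random_subset N p)"
  define Z' where "Z' i B = (if \<bar>Z i B\<bar> \<le> b then Z i B else 0)" for i B
  let ?s = "b * (2 * sqrt (p * real N * t))"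
  have "?P {B. \<bar>\<Sum>i=1..N. cbit p i B * Z i B\<bar> > ?s} \<le>
      ?P ({B. \<bar>\<Sum>i=1..N. cbit p i B * Z' i B\<bar> > ?s} \<union> (\<Union>i\<in>{1..N}. {B. \<bar>Z i B\<bar> > b}))"
  proof (rule prob_random_subset_mono)
    fix B assume B: "B \<in> {B. \<bar>\<Sum>i=1..N. cbit p i B * Z i B\<bar> > ?s}"
    show "B \<in> {B. \<bar>\<Sum>i=1..N. cbit p i B * Z' i B\<bar> > ?s} \<union> (\<Union>i\<in>{1..N}. {B. \<bar>Z i B\<bar> > b})"
    proof (cases "\<exists>i\<in>{1..N}. \<bar>Z i B\<bar> > b")
      case False
      then have "(\<Sum>i=1..N. cbit p i B * Z' i B) = (\<Sum>i=1..N. cbit p i B * Z i B)"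
        by (intro sum.cong) (auto simp: Z'_def not_less)
      then show ?thesis using B by auto
    qed auto
  qed
  also have "\<dots> \<le> ?P {B. \<bar>\<Sum>i=1..N. cbit p i B * Z' i B\<bar> > ?s} + ?P (\<Union>i\<in>{1..N}. {B. \<bar>Z i B\<bar> > b})"
    by (rule measure_Un_le) auto
  also have "\<dots> \<le> 2 * exp (- t) + (\<Sum>i=1..N. ?P {B. \<bar>Z i B\<bar> > b})"
  proof (rule add_mono)
    show "?P {B. \<bar>\<Sum>i=1..N. cbit p i B * Z' i B\<bar> > ?s} \<le> 2 * exp (- t)"
    proof (rule adapted_sum_tail_bounded[OF p _ _ b t])
      show "Z' i B = Z' i (B \<inter> {..<i})" if "i \<in> {1..N}" for i B
        unfolding Z'_def using ad[OF that, of B] by metis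
    qed (use b in \<open>auto simp: Z'_def\<close>)
    show "?P (\<Union>i\<in>{1..N}. {B. \<bar>Z i B\<bar> > b}) \<le> (\<Sum>i=1..N. ?P {B. \<bar>Z i B\<bar> > b})"
      by (rule measure_UNION_le) auto
  qed
  finally show ?thesis .
qed

section \<open>Adapted chaoses\<close>

definition ksubsets :: "nat \<Rightarrow> nat \<Rightarrow> nat set set" where
  "ksubsets N j = {S. S \<subseteq> {1..N} \<and> card S = j}"

definition cprod :: "real \<Rightarrow> nat set \<Rightarrow> nat set \<Rightarrow> real" where
  "cprod p S B = (\<Prod>i\<in>S. cbit p i B)"

lemma finite_ksubsets [simp]: "finite (ksubsets N j)"
  by (rule finite_subset[of _ "Pow {1..N}"]) (auto simp: ksubsets_def)

lemma card_ksubsets: "card (ksubsets N j) = N choose j"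
  using n_subsets[of "{1..N}" j] by (simp add: ksubsets_def)

lemma finite_mem_ksubsets: "S \<in> ksubsets N j \<Longrightarrow> finite S"
  by (auto simp: ksubsets_def intro: finite_subset)

lemma ksubsets_0: "ksubsets N 0 = {{}}"
  by (auto simp: ksubsets_def dest: finite_subset)

lemma sum_subsets_insert:
  fixes g :: "'a set \<Rightarrow> 'b::comm_monoid_add"
  assumes "finite A" "b \<notin> A"
  shows "(\<Sum>S | S \<subseteq> insert b A \<and> P S. g S)
    = (\<Sum>S | S \<subseteq> A \<and> P S. g S) + (\<Sum>S | S \<subseteq> A \<and> P (insert b S). g (insert b S))"
proof -
  have eq: "{S. S \<subseteq> insert b A \<and> P S} = {S. S \<subseteq> A \<and> P S} \<union> insert b ` {S. S \<subseteq> A \<and> P (insert b S)}"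
    (is "?L = ?A \<union> ?B")
  proof
    show "?L \<subseteq> ?A \<union> ?B"
    proof
      fix S assume S: "S \<in> ?L"
      show "S \<in> ?A \<union> ?B"
      proof (cases "b \<in> S")
        case True
        then have "S = insert b (S - {b})" by auto
        moreover have "S - {b} \<in> {S. S \<subseteq> A \<and> P (insert b S)}" using S True by (auto simp: insert_absorb)
        ultimately show ?thesis by blast
      qed (use S in auto)
    qed
  qed auto
  have fin: "finite {S. S \<subseteq> A \<and> Q S}" for Q
    by (rule finite_subset[of _ "Pow A"]) (use assms(1) in auto)
  have inj: "inj_on (insert b) {S. S \<subseteq> A \<and> P (insert b S)}"
    using assms(2) by (intro inj_onI) (metis (no_types, lifting) insert_ident mem_Collect_eq subsetD)
  show ?thesis
    unfolding eq using assms(2)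
    by (subst sum.union_disjoint) (auto simp: fin sum.reindex[OF inj])
qed

lemma sum_ksubsets_Suc:
  fixes g :: "nat set \<Rightarrow> 'b::comm_monoid_add"
  shows "(\<Sum>S\<in>ksubsets (Suc N) (Suc j). g S)
     = (\<Sum>S\<in>ksubsets N (Suc j). g S) + (\<Sum>S\<in>ksubsets N j. g (insert (Suc N) S))"
proof -
  have ins: "{1..Suc N} = insert (Suc N) {1..N}" by auto
  have "{S. S \<subseteq> {1..N} \<and> card (insert (Suc N) S) = Suc j} = ksubsets N j"
    unfolding ksubsets_def
  proof (intro Collect_cong conj_cong refl)
    fix S assume "S \<subseteq> {1..N}"
    then have "finite S" "Suc N \<notin> S" by (auto intro: finite_subset)
    then show "(card (insert (Suc N) S) = Suc j) = (card S = j)" by simp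
  qed
  then show ?thesis
    using sum_subsets_insert[of "{1..N}" "Suc N" g "\<lambda>S. card S = Suc j"]
    by (simp only: ksubsets_def ins) simp
qed

lemma sum_ksubsets_by_Max:
  fixes g :: "nat set \<Rightarrow> 'b::comm_monoid_add"
  shows "(\<Sum>S\<in>ksubsets N (Suc j). g S) = (\<Sum>i=1..N. \<Sum>S\<in>ksubsets (i - 1) j. g (insert i S))"
proof (induction N)
  case 0
  have "ksubsets 0 (Suc j) = {}" by (auto simp: ksubsets_def)
  then show ?case by simp
next
  case (Suc N)
  then show ?case by (simp add: sum_ksubsets_Suc)
qed

lemma cprod_insert:
  assumes "S \<in> ksubsets n j" "n < i"
  shows "cprod p (insert i S) B = cbit p i B * cprod p S B"
proof -
  have "finite S" "i \<notin> S" using assms finite_mem_ksubsets[OF assms(1)] by (auto simp: ksubsets_def)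
  then show ?thesis by (simp add: cprod_def)
qed

lemma insert_mem_ksubsets:
  assumes "S \<in> ksubsets (i - 1) j" "i \<in> {1..n}"
  shows "insert i S \<in> ksubsets n (Suc j)"
proof -
  have "finite S" using assms finite_mem_ksubsets by auto
  moreover have "S \<subseteq> {1..i - 1}" "card S = j" using assms(1) by (auto simp: ksubsets_def)
  moreover have "i \<notin> S" using calculation assms(2) by auto
  moreover have "S \<subseteq> {1..n}" using \<open>S \<subseteq> {1..i - 1}\<close> assms(2) by fastforce
  ultimately show ?thesis using assms(2) by (auto simp: ksubsets_def)
qed

text \<open>
  A coefficient \<open>c S\<close> may depend on the elements of the random set lying below all of \<open>S\<close>.
  Peeling off the largest element of \<open>S\<close> exhibits the chaos of order \<open>j + 1\<close> as a martingale
  whose increments are bounded, up to a union bound, by the estimate for chaoses of order \<open>j\<close>.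
\<close>

lemma chaos_tail:
  assumes p: "0 \<le> p" "p \<le> 1" and b: "0 \<le> b" and t: "0 \<le> t" "t \<le> p * real N"
    and n: "n \<le> N"
    and cb: "\<And>S B. S \<in> ksubsets n j \<Longrightarrow> \<bar>c S B\<bar> \<le> b"
    and ad: "\<And>S B. S \<in> ksubsets n j \<Longrightarrow> c S B = c S (B \<inter> {i. \<forall>s\<in>S. i < s})"
  shows "measure_pmf.prob (random_subset N p)
      {B. \<bar>\<Sum>S\<in>ksubsets n j. c S B * cprod p S B\<bar> > b * (2 * sqrt (p * real N * t)) ^ j}
     \<le> 2 * (\<Sum>i<j. real N ^ i) * exp (- t)"
  using n cb ad
proof (induction j arbitrary: n c)
  case 0
  have "\<bar>c {} B\<bar> \<le> b" for B using "0.prems"(2)[of "{}"] by (simp add: ksubsets_0)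
  then have "{B. \<bar>c {} B\<bar> > b} = {}" by (auto simp: not_less)
  then show ?case by (simp add: ksubsets_0 cprod_def)
next
  case (Suc j)
  let ?P = "measure_pmf.prob (random_subset N p)"
  let ?q = "2 * sqrt (p * real N * t)"
  \<comment> \<open>Padded by 0 beyond \<open>n\<close>: the range of the sets shrinks in the
    induction, while the probability space and the martingale bound stay on the full
    \<open>{1..N}\<close>.\<close>
  define Z where "Z i B = (if i \<le> n then \<Sum>S\<in>ksubsets (i - 1) j. c (insert i S) B * cprod p S B else 0)" for i B
  have sum_eq: "(\<Sum>S\<in>ksubsets n (Suc j). c S B * cprod p S B) = (\<Sum>i=1..N. cbit p i B * Z i B)" for B
  proof -
    have "(\<Sum>S\<in>ksubsets n (Suc j). c S B * cprod p S B) = (\<Sum>i=1..n. cbit p i B * Z i B)"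
      unfolding sum_ksubsets_by_Max
      by (intro sum.cong) (auto simp: Z_def sum_distrib_left cprod_insert intro!: sum.cong)
    also have "\<dots> = (\<Sum>i=1..N. cbit p i B * Z i B)"
      using Suc.prems(1) by (intro sum.mono_neutral_left) (auto simp: Z_def)
    finally show ?thesis .
  qed
  have Zad: "Z i B = Z i (B \<inter> {..<i})" if i: "i \<in> {1..N}" for i B
  proof (cases "i \<le> n")
    case True
    have "c (insert i S) B * cprod p S B = c (insert i S) (B \<inter> {..<i}) * cprod p S (B \<inter> {..<i})"
      if S: "S \<in> ksubsets (i - 1) j" for S
    proof -
      have ins: "insert i S \<in> ksubsets n (Suc j)" using insert_mem_ksubsets[OF S] i True by auto
      have L: "B \<inter> {x. \<forall>s\<in>insert i S. x < s} = B \<inter> {..<i} \<inter> {x. \<forall>s\<in>insert i S. x < s}" by auto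
      have "c (insert i S) B = c (insert i S) (B \<inter> {x. \<forall>s\<in>insert i S. x < s})"
        by (rule Suc.prems(3)[OF ins])
      also have "\<dots> = c (insert i S) (B \<inter> {..<i})"
        unfolding L by (rule Suc.prems(3)[OF ins, symmetric])
      finally have "c (insert i S) B = c (insert i S) (B \<inter> {..<i})" .
      moreover have "cprod p S B = cprod p S (B \<inter> {..<i})"
        unfolding cprod_def using S i by (intro prod.cong) (auto simp: cbit_def ksubsets_def)
      ultimately show ?thesis by simp
    qed
    then show ?thesis using True by (simp add: Z_def)
  qed (simp add: Z_def)
  have Zb: "?P {B. \<bar>Z i B\<bar> > b * ?q ^ j} \<le> 2 * (\<Sum>i<j. real N ^ i) * exp (- t)"
    if i: "i \<in> {1..N}" for i
  proof (cases "i \<le> n")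
    case True
    have "?P {B. \<bar>\<Sum>S\<in>ksubsets (i - 1) j. c (insert i S) B * cprod p S B\<bar> > b * ?q ^ j}
        \<le> 2 * (\<Sum>i<j. real N ^ i) * exp (- t)"
    proof (rule Suc.IH)
      show "i - 1 \<le> N" using i by auto
      fix S B assume S: "S \<in> ksubsets (i - 1) j"
      have ins: "insert i S \<in> ksubsets n (Suc j)" using insert_mem_ksubsets[OF S] i True by auto
      show "\<bar>c (insert i S) B\<bar> \<le> b" by (rule Suc.prems(2)[OF ins])
      have L: "B \<inter> {x. \<forall>s\<in>insert i S. x < s}
          = B \<inter> {x. \<forall>s\<in>S. x < s} \<inter> {x. \<forall>s\<in>insert i S. x < s}" by auto
      have "c (insert i S) B = c (insert i S) (B \<inter> {x. \<forall>s\<in>insert i S. x < s})"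
        by (rule Suc.prems(3)[OF ins])
      also have "\<dots> = c (insert i S) (B \<inter> {x. \<forall>s\<in>S. x < s})"
        unfolding L by (rule Suc.prems(3)[OF ins, symmetric])
      finally show "c (insert i S) B = c (insert i S) (B \<inter> {x. \<forall>s\<in>S. x < s})" .
    qed
    then show ?thesis using True by (simp add: Z_def)
  next
    case False
    have "0 \<le> b * ?q ^ j" using b p t by simp
    then have "{B. \<bar>Z i B\<bar> > b * ?q ^ j} = {}" using False by (auto simp: Z_def)
    then show ?thesis by (simp add: sum_nonneg)
  qed
  have "?P {B. \<bar>\<Sum>S\<in>ksubsets n (Suc j). c S B * cprod p S B\<bar> > b * ?q ^ Suc j}
      = ?P {B. \<bar>\<Sum>i=1..N. cbit p i B * Z i B\<bar> > b * ?q ^ j * ?q}"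
    by (simp add: sum_eq mult_ac)
  also have "\<dots> \<le> 2 * exp (- t) + (\<Sum>i=1..N. ?P {B. \<bar>Z i B\<bar> > b * ?q ^ j})"
    using b p t by (intro adapted_sum_tail p t Zad) auto
  also have "\<dots> \<le> 2 * exp (- t) + (\<Sum>i=1..N. 2 * (\<Sum>i<j. real N ^ i) * exp (- t))"
    by (intro add_mono sum_mono Zb) auto
  \<comment> \<open>Each order multiplies the previous failure probability by \<open>N\<close> and
    adds one martingale bound, which is the recursion of the geometric sum.\<close>
  also have "\<dots> = 2 * (\<Sum>i<Suc j. real N ^ i) * exp (- t)"
    by (subst sum.lessThan_Suc_shift) (simp add: sum_distrib_left algebra_simps)
  finally show ?case .
qed

section \<open>Elementary symmetric polynomials of the centred bits\<close>

definition esym :: "nat \<Rightarrow> nat \<Rightarrow> real \<Rightarrow> nat set \<Rightarrow> real" where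
  "esym N j p B = (\<Sum>S\<in>ksubsets N j. cprod p S B)"

lemma esym_0: "esym N 0 p B = 1"
  by (simp add: esym_def ksubsets_0 cprod_def)

lemma esym_0_Suc: "esym 0 (Suc j) p B = 0"
proof -
  have "ksubsets 0 (Suc j) = {}" by (auto simp: ksubsets_def)
  then show ?thesis by (simp add: esym_def)
qed

lemma esym_Suc_Suc: "esym (Suc N) (Suc j) p B = esym N (Suc j) p B + cbit p (Suc N) B * esym N j p B"
  by (simp add: esym_def sum_ksubsets_Suc sum_distrib_left cprod_insert)

lemma esym_1: "esym N (Suc 0) p B = csum N p B"
  by (induction N) (simp_all add: esym_0_Suc esym_Suc_Suc esym_0 csum_def)

text \<open>The three-term recurrence of the Krawtchouk polynomials; it rests on \<open>y\<^sup>2 = (1 - 2p) y + p (1 - p)\<close>.\<close>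

lemma esym_recurrence:
  "real (j + 2) * esym N (j + 2) p B = (csum N p B - (1 - 2 * p) * real (j + 1)) * esym N (j + 1) p B
     - p * (1 - p) * (real N - real j) * esym N j p B"
proof (induction N arbitrary: j)
  case 0
  show ?case by (cases j) (simp_all add: esym_0_Suc csum_def)
next
  case (Suc N)
  define y where "y = cbit p (Suc N) B"
  have y2: "y * y = (1 - 2 * p) * y + p * (1 - p)"
    by (cases "Suc N \<in> B") (simp_all add: y_def cbit_def algebra_simps)
  have cs: "csum (Suc N) p B = csum N p B + y" by (simp add: csum_def y_def)
  show ?case
  \<comment> \<open>Adding a vertex mixes order j with order j - 1, so the induction hypothesis is
    used at j and at j - 1; for j = 0 only the first one exists.\<close>
  proof (cases j)
    case 0
    have n: "0 + 2 = Suc (Suc 0)" "0 + 1 = Suc 0" by simp_all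
    have e: "esym (Suc N) (Suc (Suc 0)) p B = esym N (Suc (Suc 0)) p B + y * csum N p B"
      unfolding esym_Suc_Suc esym_1 y_def ..
    have "2 * esym N (Suc (Suc 0)) p B = (csum N p B - (1 - 2 * p)) * csum N p B - p * (1 - p) * real N"
      using Suc.IH[of 0] unfolding n esym_1 esym_0 by simp
    then have "2 * (esym N (Suc (Suc 0)) p B + y * csum N p B)
        = (csum N p B + y - (1 - 2 * p)) * (csum N p B + y) - p * (1 - p) * (real N + 1)"
      using y2 by algebra
    then show ?thesis unfolding 0 n e esym_1 esym_0 cs by (simp add: add.commute)
  next
    case (Suc i)
    have e: "esym (Suc N) (j + 2) p B = esym N (j + 2) p B + y * esym N (j + 1) p B"
      "esym (Suc N) (j + 1) p B = esym N (j + 1) p B + y * esym N j p B"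
      "esym (Suc N) j p B = esym N j p B + y * esym N i p B"
      using esym_Suc_Suc[of N "Suc j" p B] esym_Suc_Suc[of N "j" p B] esym_Suc_Suc[of N i p B]
      by (simp_all add: y_def Suc)
    have j: "real j = real i + 1" using Suc by simp
    have a: "(real i + 3) * esym N (j + 2) p B = (csum N p B - (1 - 2 * p) * (real i + 2)) * esym N (j + 1) p B
         - p * (1 - p) * (real N - real i - 1) * esym N j p B"
      using Suc.IH[of j] by (simp add: j algebra_simps)
    have b: "(real i + 2) * esym N (j + 1) p B = (csum N p B - (1 - 2 * p) * (real i + 1)) * esym N j p B
         - p * (1 - p) * (real N - real i) * esym N i p B"
      using Suc.IH[of i] by (simp add: Suc algebra_simps)
    have "(real i + 3) * (esym N (j + 2) p B + y * esym N (j + 1) p B) =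
       (csum N p B + y - (1 - 2 * p) * (real i + 2)) * (esym N (j + 1) p B + y * esym N j p B)
       - p * (1 - p) * (real N - real i) * (esym N j p B + y * esym N i p B)"
      using a b y2 by algebra
    then show ?thesis unfolding e cs by (simp add: j algebra_simps)
  qed
qed

lemma esym_eq_0: "N < j \<Longrightarrow> esym N j p B = 0"
proof -
  assume "N < j"
  then have "card (ksubsets N j) = 0" by (simp add: card_ksubsets)
  then have "ksubsets N j = {}" by simp
  then show ?thesis by (simp add: esym_def)
qed

text \<open>In the three-term recurrence the factor of order j + 1 is O(a) and the one of order j is
  at most p N \<le> a^2, so each order gains one factor a. The constant is uniform in
  \<open>N\<close>, \<open>p\<close>, \<open>B\<close> and \<open>a\<close>; the lemma is applied
  with a = \<delta> p N.\<close>

lemma esym_bound: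
  assumes "0 \<le> C"
  shows "\<exists>D\<ge>0. \<forall>N p B a. 0 \<le> p \<longrightarrow> p \<le> 1 \<longrightarrow> 1 \<le> a \<longrightarrow> p * real N \<le> a\<^sup>2 \<longrightarrow> \<bar>csum N p B\<bar> \<le> C * a
           \<longrightarrow> \<bar>esym N j p B\<bar> \<le> D * a ^ j"
proof (induction j rule: induct_nat_012)
  case 0
  show ?case by (rule exI[of _ 1]) (simp add: esym_0)
next
  case 1
  show ?case by (rule exI[of _ C]) (simp add: esym_1 assms)
next
  case (ge2 j)
  from ge2(1) obtain D0 where D0: "D0 \<ge> 0" "\<forall>N p B a. 0 \<le> p \<longrightarrow> p \<le> 1 \<longrightarrow> 1 \<le> a \<longrightarrow>
      p * real N \<le> a\<^sup>2 \<longrightarrow> \<bar>csum N p B\<bar> \<le> C * a \<longrightarrow> \<bar>esym N j p B\<bar> \<le> D0 * a ^ j" by (elim exE conjE)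
  from ge2(2) obtain D1 where D1: "D1 \<ge> 0" "\<forall>N p B a. 0 \<le> p \<longrightarrow> p \<le> 1 \<longrightarrow> 1 \<le> a \<longrightarrow>
      p * real N \<le> a\<^sup>2 \<longrightarrow> \<bar>csum N p B\<bar> \<le> C * a \<longrightarrow> \<bar>esym N (Suc j) p B\<bar> \<le> D1 * a ^ Suc j" by (elim exE conjE)
  define D where "D = (C + real (j + 1)) * D1 + D0"
  show ?case
  proof (intro exI[of _ D] conjI allI impI)
    show "D \<ge> 0" using D0(1) D1(1) assms by (simp add: D_def)
    fix N p B a
    assume h: "0 \<le> p" "p \<le> 1" "(1::real) \<le> a" "p * real N \<le> a\<^sup>2" "\<bar>csum N p B\<bar> \<le> C * a"
    have e0: "\<bar>esym N j p B\<bar> \<le> D0 * a ^ j" and e1: "\<bar>esym N (Suc j) p B\<bar> \<le> D1 * a ^ Suc j"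
      using D0(2) D1(2) h by blast+
    have x: "\<bar>csum N p B - (1 - 2 * p) * real (j + 1)\<bar> \<le> (C + real (j + 1)) * a"
    proof -
      have "\<bar>(1 - 2 * p) * real (j + 1)\<bar> \<le> 1 * real (j + 1)"
        unfolding abs_mult using h by (intro mult_mono) auto
      also have "\<dots> \<le> real (j + 1) * a" using h by (simp add: mult_le_cancel_left1)
      finally show ?thesis using h(5) abs_triangle_ineq4[of "csum N p B" "(1 - 2 * p) * real (j + 1)"]
        unfolding ring_distribs(2) by linarith
    qed
    have y: "\<bar>p * (1 - p) * (real N - real j) * esym N j p B\<bar> \<le> a\<^sup>2 * (D0 * a ^ j)"
    \<comment> \<open>For j > N the factor \<open>real N - real j\<close> is negative, but then
      \<open>esym N j p B\<close> vanishes.\<close>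
    proof (cases "j \<le> N")
      case True
      have "p * (1 - p) * (real N - real j) \<le> p * 1 * real N"
        using h True by (intro mult_mono) auto
      then have "p * (1 - p) * (real N - real j) \<le> a\<^sup>2" using h by simp
      moreover have "0 \<le> p * (1 - p) * (real N - real j)" using h True by simp
      ultimately show ?thesis unfolding abs_mult[of _ "esym N j p B"]
        using e0 by (intro mult_mono) auto
    next
      case False
      then show ?thesis using D0(1) h by (simp add: esym_eq_0)
    qed
    have "\<bar>esym N (j + 2) p B\<bar> \<le> real (j + 2) * \<bar>esym N (j + 2) p B\<bar>"
      by (simp add: mult_le_cancel_right1)
    also have "\<dots> = \<bar>real (j + 2) * esym N (j + 2) p B\<bar>" by (simp add: abs_mult)
    also have "\<dots> \<le> \<bar>csum N p B - (1 - 2 * p) * real (j + 1)\<bar> * \<bar>esym N (j + 1) p B\<bar>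
         + \<bar>p * (1 - p) * (real N - real j) * esym N j p B\<bar>"
      unfolding esym_recurrence by (rule order.trans[OF abs_triangle_ineq4]) (simp add: abs_mult)
    also have "\<dots> \<le> (C + real (j + 1)) * a * (D1 * a ^ Suc j) + a\<^sup>2 * (D0 * a ^ j)"
      using e1 h assms D1(1) by (intro add_mono mult_mono x y) auto
    also have "\<dots> = D * a ^ (j + 2)" by (simp add: D_def algebra_simps power2_eq_square)
    finally show "\<bar>esym N (Suc (Suc j)) p B\<bar> \<le> D * a ^ Suc (Suc j)" by simp
  qed
qed

section \<open>Expansion of the edge count\<close>

text \<open>Every x_b is written as p + (x_b - p), from the maximum downwards, and the expansion
  stops once r centred factors are chosen. A vertex passed over before that contributes p; the
  vertices below the r chosen ones are left as they are. When a new maximum b is added, both sums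
  obey the recursion of the product: p times the value for r plus x_b - p times the value for r -
  1.\<close>

lemma prod_expansion_centred:
  fixes x :: "'a::linorder \<Rightarrow> real"
  assumes "finite e"
  shows "(\<Prod>i\<in>e. x i) =
     (\<Sum>S | S \<subseteq> e \<and> card S < r. p ^ (card e - card S) * (\<Prod>i\<in>S. x i - p))
   + (\<Sum>S | S \<subseteq> e \<and> card S = r. (\<Prod>i\<in>e - S. if \<forall>s\<in>S. i < s then x i else p) * (\<Prod>i\<in>S. x i - p))"
  using assms
proof (induction e arbitrary: r rule: finite_linorder_max_induct)
  case empty
  show ?case
  proof (cases r)
    case 0
    have "{S::'a set. S = {} \<and> card S = 0} = {{}}" by auto
    then show ?thesis using 0 by simp
  next
    case (Suc r')
    have a: "{S::'a set. S = {} \<and> card S < r} = {{}}" "{S::'a set. S = {} \<and> card S = r} = {}"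
      using Suc by auto
    show ?thesis by (simp add: a)
  qed
next
  case (insert b A)
  define L where "L A r = (\<Sum>S | S \<subseteq> A \<and> card S < r. p ^ (card A - card S) * (\<Prod>i\<in>S. x i - p))" for A r
  define g where "g A S = (\<Prod>i\<in>A - S. if \<forall>s\<in>S. i < s then x i else p)" for A S
  define R where "R A r = (\<Sum>S | S \<subseteq> A \<and> card S = r. g A S * (\<Prod>i\<in>S. x i - p))" for A r
  have IH: "(\<Prod>i\<in>A. x i) = L A r + R A r" for r
    unfolding L_def R_def g_def by (rule insert.IH)
  have b: "b \<notin> A" using insert.hyps by auto
  have fin: "finite S" "b \<notin> S" "card (insert b S) = Suc (card S)" "card S \<le> card A" if "S \<subseteq> A" for S
  proof -
    show "finite S" using that insert.hyps(1) by (rule finite_subset)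
    show "b \<notin> S" using that b by auto
    show "card (insert b S) = Suc (card S)" using \<open>finite S\<close> \<open>b \<notin> S\<close> by simp
    show "card S \<le> card A" using that insert.hyps(1) by (simp add: card_mono)
  qed
  show ?case
  proof (cases r)
    case 0
    have s: "{S. S \<subseteq> insert b A \<and> card S = 0} = {{}}"
      using insert.hyps(1) by (auto dest: finite_subset)
    show ?thesis unfolding 0 s by simp
  next
    case (Suc r')
    have "L (insert b A) r = p * L A r + (x b - p) * L A r'"
    proof -
      have "{S. S \<subseteq> A \<and> card (insert b S) < r} = {S. S \<subseteq> A \<and> card S < r'}"
        using fin(3) Suc by auto
      then have "L (insert b A) r = (\<Sum>S | S \<subseteq> A \<and> card S < r. p ^ (card (insert b A) - card S) * (\<Prod>i\<in>S. x i - p))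
         + (\<Sum>S | S \<subseteq> A \<and> card S < r'. p ^ (card (insert b A) - card (insert b S)) * (\<Prod>i\<in>insert b S. x i - p))"
        unfolding L_def by (simp add: sum_subsets_insert[OF insert.hyps(1) b])
      also have "\<dots> = p * L A r + (x b - p) * L A r'"
        unfolding L_def sum_distrib_left
        using insert.hyps(1) b fin by (intro arg_cong2[of _ _ _ _ "(+)"] sum.cong) (auto simp: Suc_diff_le)
      finally show ?thesis .
    qed
    moreover have "R (insert b A) r = p * R A r + (x b - p) * R A r'"
    proof -
      have "{S. S \<subseteq> A \<and> card (insert b S) = r} = {S. S \<subseteq> A \<and> card S = r'}"
        using fin(3) Suc by auto
      then have "R (insert b A) r = (\<Sum>S | S \<subseteq> A \<and> card S = r. g (insert b A) S * (\<Prod>i\<in>S. x i - p))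
         + (\<Sum>S | S \<subseteq> A \<and> card S = r'. g (insert b A) (insert b S) * (\<Prod>i\<in>insert b S. x i - p))"
        unfolding R_def by (simp add: sum_subsets_insert[OF insert.hyps(1) b])
      also have "\<dots> = (\<Sum>S | S \<subseteq> A \<and> card S = r. p * (g A S * (\<Prod>i\<in>S. x i - p)))
         + (\<Sum>S | S \<subseteq> A \<and> card S = r'. (x b - p) * (g A S * (\<Prod>i\<in>S. x i - p)))"
      proof (intro arg_cong2[of _ _ _ _ "(+)"] sum.cong refl)
        \<comment> \<open>As r > 0, the set S has an element, and it lies below b; hence b is not
          below S and contributes the factor p.\<close>
        fix S assume S: "S \<in> {S. S \<subseteq> A \<and> card S = r}"
        then obtain s where s: "s \<in> S" using Suc by fastforce
        then have sb: "\<not> b < s" using S insert.hyps(2) by fastforce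
        have "insert b A - S = insert b (A - S)" using S b by auto
        then have "g (insert b A) S = p * g A S"
          unfolding g_def using insert.hyps(1) b s sb by auto
        then show "g (insert b A) S * (\<Prod>i\<in>S. x i - p) = p * (g A S * (\<Prod>i\<in>S. x i - p))" by simp
      next
        \<comment> \<open>All of A lies below b, so putting b into S does not change which vertices
          lie below the chosen ones.\<close>
        fix S assume S: "S \<in> {S. S \<subseteq> A \<and> card S = r'}"
        have "insert b A - insert b S = A - S" using b by auto
        then have "g (insert b A) (insert b S) = g A S"
          unfolding g_def using insert.hyps(2) by (intro prod.cong) auto
        then show "g (insert b A) (insert b S) * (\<Prod>i\<in>insert b S. x i - p) = (x b - p) * (g A S * (\<Prod>i\<in>S. x i - p))"
          using S fin[of S] by simp
      qed
      finally show ?thesis by (simp add: R_def sum_distrib_left)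
    qed
    moreover have "(\<Prod>i\<in>insert b A. x i) = p * (\<Prod>i\<in>A. x i) + (x b - p) * (\<Prod>i\<in>A. x i)"
      using insert.hyps(1) b by (simp add: algebra_simps)
    ultimately have "(\<Prod>i\<in>insert b A. x i) = L (insert b A) r + R (insert b A) r"
      using IH[of r] IH[of r'] by algebra
    then show ?thesis unfolding L_def R_def g_def .
  qed
qed

text \<open>The coefficient \<open>G\<^sub>S\<close> of the overview. Vertices of an edge outside S
  that are not below S were passed over in the expansion and carry p.\<close>

definition tail_coeff :: "real \<Rightarrow> nat set set \<Rightarrow> nat set \<Rightarrow> nat set \<Rightarrow> real" where
  "tail_coeff p H S B = (\<Sum>e | e \<in> H \<and> S \<subseteq> e. \<Prod>i\<in>e - S. if \<forall>s\<in>S. i < s then of_bool (i \<in> B) else p)"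

lemma tail_coeff_bounds:
  assumes "0 \<le> p" "p \<le> 1"
  shows "\<bar>tail_coeff p H S B\<bar> \<le> real (hdegree H S)"
proof -
  have "\<bar>tail_coeff p H S B\<bar> \<le> (\<Sum>e | e \<in> H \<and> S \<subseteq> e. 1)"
    unfolding tail_coeff_def
  proof (rule order.trans[OF sum_abs], rule sum_mono)
    fix e assume "e \<in> {e. e \<in> H \<and> S \<subseteq> e}"
    show "\<bar>\<Prod>i\<in>e - S. if \<forall>s\<in>S. i < s then of_bool (i \<in> B) else p\<bar> \<le> 1"
      unfolding abs_prod using assms by (intro prod_le_1) auto
  qed
  then show ?thesis by (simp add: hdegree_def)
qed

lemma tail_coeff_adapted:
  "tail_coeff p H S B = tail_coeff p H S (B \<inter> {i. \<forall>s\<in>S. i < s})"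
  unfolding tail_coeff_def by (intro sum.cong prod.cong) auto

lemma uniform_hypergraph_finite:
  assumes "uniform_hypergraph k N H"
  shows "finite H"
  by (rule finite_subset[of _ "Pow {1..N}"]) (use assms in \<open>auto simp: uniform_hypergraph_def\<close>)

lemma edges_in_eq_sum_prod:
  assumes "uniform_hypergraph k N H"
  shows "real (edges_in H B) = (\<Sum>e\<in>H. \<Prod>i\<in>e. of_bool (i \<in> B))"
proof -
  have "(\<Prod>i\<in>e. of_bool (i \<in> B)) = (of_bool (e \<subseteq> B) :: real)" if "e \<in> H" for e
  proof -
    have "finite e" using that assms by (auto simp: uniform_hypergraph_def intro: finite_subset)
    then show ?thesis by (induction e) auto
  qed
  then have "(\<Sum>e\<in>H. \<Prod>i\<in>e. of_bool (i \<in> B)) = (\<Sum>e\<in>H. of_bool (e \<subseteq> B) :: real)" by simp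
  also have "\<dots> = real (edges_in H B)"
    using uniform_hypergraph_finite[OF assms]
    by (simp add: edges_in_def of_bool_def sum.If_cases Int_def)
  finally show ?thesis by simp
qed

text \<open>Sum \<open>prod_expansion_centred\<close> over all edges and exchange sums: counting the
  edges above a fixed S produces \<open>hdegree\<close> and \<open>tail_coeff\<close>. The term j =
  0 is the mean \<open>p ^ k * real (card H)\<close>, which the deviation subtracts.\<close>

lemma deviation_expansion:
  assumes H: "uniform_hypergraph k N H" and r: "1 \<le> r"
  shows "deviation k H p B =
    (\<Sum>j=1..<r. p ^ (k - j) * (\<Sum>S\<in>ksubsets N j. real (hdegree H S) * cprod p S B))
     + (\<Sum>S\<in>ksubsets N r. tail_coeff p H S B * cprod p S B)"
proof -
  have fH: "finite H" by (rule uniform_hypergraph_finite[OF H])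
  have e: "finite e" "card e = k" "e \<subseteq> {1..N}" if "e \<in> H" for e
    using that H by (auto simp: uniform_hypergraph_def intro: finite_subset)
  define g where "g e S = (\<Prod>i\<in>e - S. if \<forall>s\<in>S. i < s then of_bool (i \<in> B) else p)" for e S
  have lower: "(\<Sum>S | S \<subseteq> e \<and> card S < r. p ^ (k - card S) * cprod p S B)
      = (\<Sum>j<r. \<Sum>S\<in>ksubsets N j. of_bool (S \<subseteq> e) * (p ^ (k - j) * cprod p S B))" if "e \<in> H" for e
  proof -
    have "(\<Sum>j<r. \<Sum>S\<in>ksubsets N j. of_bool (S \<subseteq> e) * (p ^ (k - j) * cprod p S B))
        = (\<Sum>j<r. \<Sum>S | S \<subseteq> e \<and> card S = j. p ^ (k - card S) * cprod p S B)"
      using e[OF that]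
      by (intro sum.cong refl sum.mono_neutral_cong_right) (auto simp: ksubsets_def)
    also have "\<dots> = (\<Sum>S\<in>(\<Union>j\<in>{..<r}. {S. S \<subseteq> e \<and> card S = j}). p ^ (k - card S) * cprod p S B)"
      using e(1)[OF that] by (subst sum.UNION_disjoint) auto
    also have "(\<Union>j\<in>{..<r}. {S. S \<subseteq> e \<and> card S = j}) = {S. S \<subseteq> e \<and> card S < r}" by auto
    finally show ?thesis by simp
  qed
  have upper: "(\<Sum>S | S \<subseteq> e \<and> card S = r. g e S * cprod p S B)
      = (\<Sum>S\<in>ksubsets N r. of_bool (S \<subseteq> e) * g e S * cprod p S B)" if "e \<in> H" for e
    using e[OF that] by (intro sum.mono_neutral_cong_left) (auto simp: ksubsets_def)
  have deg: "(\<Sum>e\<in>H. of_bool (S \<subseteq> e)) = real (hdegree H S)" for S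
    using fH by (simp add: hdegree_def of_bool_def sum.If_cases Int_def)
  have tc: "(\<Sum>e\<in>H. of_bool (S \<subseteq> e) * g e S) = tail_coeff p H S B" for S
    unfolding tail_coeff_def g_def using fH by (intro sum.mono_neutral_cong_right) auto
  have "real (edges_in H B) = (\<Sum>e\<in>H. (\<Sum>S | S \<subseteq> e \<and> card S < r. p ^ (k - card S) * cprod p S B)
      + (\<Sum>S | S \<subseteq> e \<and> card S = r. g e S * cprod p S B))"
    unfolding edges_in_eq_sum_prod[OF H]
  proof (rule sum.cong[OF refl])
    fix x assume x: "x \<in> H"
    show "(\<Prod>i\<in>x. of_bool (i \<in> B)) = (\<Sum>S | S \<subseteq> x \<and> card S < r. p ^ (k - card S) * cprod p S B)
      + (\<Sum>S | S \<subseteq> x \<and> card S = r. g x S * cprod p S B)"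
      using prod_expansion_centred[OF e(1)[OF x], of "\<lambda>i. of_bool (i \<in> B)" p r] e(2)[OF x]
      by (simp add: g_def cprod_def cbit_def)
  qed
  also have "\<dots> = (\<Sum>e\<in>H. \<Sum>j<r. \<Sum>S\<in>ksubsets N j. of_bool (S \<subseteq> e) * (p ^ (k - j) * cprod p S B))
      + (\<Sum>e\<in>H. \<Sum>S\<in>ksubsets N r. of_bool (S \<subseteq> e) * g e S * cprod p S B)"
    by (simp add: sum.distrib lower upper)
  also have "(\<Sum>e\<in>H. \<Sum>j<r. \<Sum>S\<in>ksubsets N j. of_bool (S \<subseteq> e) * (p ^ (k - j) * cprod p S B))
      = (\<Sum>j<r. \<Sum>S\<in>ksubsets N j. \<Sum>e\<in>H. of_bool (S \<subseteq> e) * (p ^ (k - j) * cprod p S B))"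
    by (rule trans[OF sum.swap], rule sum.cong[OF refl], rule sum.swap)
  also have "\<dots> = (\<Sum>j<r. p ^ (k - j) * (\<Sum>S\<in>ksubsets N j. real (hdegree H S) * cprod p S B))"
    unfolding sum_distrib_right[symmetric] deg by (simp add: sum_distrib_left mult_ac)
  also have "(\<Sum>e\<in>H. \<Sum>S\<in>ksubsets N r. of_bool (S \<subseteq> e) * g e S * cprod p S B)
      = (\<Sum>S\<in>ksubsets N r. \<Sum>e\<in>H. of_bool (S \<subseteq> e) * g e S * cprod p S B)"
    by (rule sum.swap)
  also have "\<dots> = (\<Sum>S\<in>ksubsets N r. tail_coeff p H S B * cprod p S B)"
    unfolding sum_distrib_right[symmetric] tc ..
  also have "(\<Sum>j<r. p ^ (k - j) * (\<Sum>S\<in>ksubsets N j. real (hdegree H S) * cprod p S B))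
      = p ^ k * real (card H) + (\<Sum>j=1..<r. p ^ (k - j) * (\<Sum>S\<in>ksubsets N j. real (hdegree H S) * cprod p S B))"
  proof -
    have "{..<r} = insert 0 {1..<r}" using r by auto
    then show ?thesis by (simp add: ksubsets_0 cprod_def hdegree_def)
  qed
  finally show ?thesis by (simp add: deviation_def)
qed

section \<open>Degrees\<close>

lemma card_subsets_between:
  assumes "finite e" "S \<subseteq> e" "card S \<le> m"
  shows "card {T. S \<subseteq> T \<and> T \<subseteq> e \<and> card T = m} = (card e - card S) choose (m - card S)"
proof -
  have fS: "finite S" using assms finite_subset by auto
  have "{T. S \<subseteq> T \<and> T \<subseteq> e \<and> card T = m} = (\<union>) S ` {U. U \<subseteq> e - S \<and> card U = m - card S}" (is "?L = ?R")
  proof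
    show "?L \<subseteq> ?R"
    proof
      fix T assume T: "T \<in> ?L"
      then have "T = S \<union> (T - S)" "T - S \<subseteq> e - S" "card (T - S) = m - card S"
        using fS by (auto simp: card_Diff_subset)
      then show "T \<in> ?R" by blast
    qed
    show "?R \<subseteq> ?L"
    proof
      fix T assume "T \<in> ?R"
      then obtain U where U: "T = S \<union> U" "U \<subseteq> e - S" "card U = m - card S" by auto
      have "finite U" using U(2) assms(1) finite_subset by blast
      then have "card T = m" unfolding U(1) using U fS assms(3) by (subst card_Un_disjoint) auto
      then show "T \<in> ?L" using U assms(2) by auto
    qed
  qed
  moreover have "inj_on ((\<union>) S) {U. U \<subseteq> e - S \<and> card U = m - card S}"
    by (rule inj_onI) blast
  ultimately have "card {T. S \<subseteq> T \<and> T \<subseteq> e \<and> card T = m} = card {U. U \<subseteq> e - S \<and> card U = m - card S}"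
    by (simp add: card_image)
  also have "\<dots> = card (e - S) choose (m - card S)"
    using assms by (intro n_subsets) auto
  finally show ?thesis using fS assms by (simp add: card_Diff_subset)
qed

text \<open>Double counting of the pairs (T, e) with S \<subseteq> T \<subseteq> e.\<close>

lemma sum_hdegree_supersets:
  assumes H: "uniform_hypergraph k N H" and S: "S \<in> ksubsets N j" and "j \<le> m"
  shows "(\<Sum>T | T \<in> ksubsets N m \<and> S \<subseteq> T. hdegree H T) = hdegree H S * ((k - j) choose (m - j))"
proof -
  have fH: "finite H" by (rule uniform_hypergraph_finite[OF H])
  have e: "finite e" "card e = k" "e \<subseteq> {1..N}" if "e \<in> H" for e
    using that H by (auto simp: uniform_hypergraph_def intro: finite_subset)
  let ?I = "{T. T \<in> ksubsets N m \<and> S \<subseteq> T}"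
  have fI: "finite ?I" by (rule finite_subset[OF _ finite_ksubsets[of N m]]) auto
  have "(\<Sum>T\<in>?I. hdegree H T) = (\<Sum>T\<in>?I. \<Sum>e\<in>H. of_bool (T \<subseteq> e))"
    using fH by (simp add: hdegree_def of_bool_def sum.If_cases Int_def)
  also have "\<dots> = (\<Sum>e\<in>H. \<Sum>T\<in>?I. of_bool (T \<subseteq> e))" by (rule sum.swap)
  also have "\<dots> = (\<Sum>e\<in>H. of_bool (S \<subseteq> e) * ((k - j) choose (m - j)))"
  proof (rule sum.cong[OF refl])
    fix x assume x: "x \<in> H"
    have "(\<Sum>T\<in>?I. of_bool (T \<subseteq> x)) = card {T \<in> ?I. T \<subseteq> x}"
      using fI by (simp add: of_bool_def sum.If_cases Int_def)
    also have "{T \<in> ?I. T \<subseteq> x} = {T. S \<subseteq> T \<and> T \<subseteq> x \<and> card T = m}"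
      using e(3)[OF x] by (auto simp: ksubsets_def)
    also have "card \<dots> = of_bool (S \<subseteq> x) * ((k - j) choose (m - j))"
    proof (cases "S \<subseteq> x")
      case True
      then show ?thesis using card_subsets_between[OF e(1)[OF x] True, of m] e(2)[OF x] S \<open>j \<le> m\<close>
        by (simp add: ksubsets_def)
    next
      case False
      then have empty: "{T. S \<subseteq> T \<and> T \<subseteq> x \<and> card T = m} = {}" by auto
      show ?thesis unfolding empty using False by simp
    qed
    finally show "(\<Sum>T\<in>?I. of_bool (T \<subseteq> x)) = of_bool (S \<subseteq> x) * ((k - j) choose (m - j))" .
  qed
  also have "\<dots> = hdegree H S * ((k - j) choose (m - j))"
    unfolding sum_distrib_right[symmetric]
    using fH by (simp add: hdegree_def of_bool_def sum.If_cases Int_def)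
  finally show ?thesis .
qed

lemma hdegree_le_max_degree:
  assumes "S \<in> ksubsets N r"
  shows "hdegree H S \<le> max_degree r N H"
  unfolding max_degree_def ksubsets_def[symmetric] using assms by (intro Max_ge) auto

text \<open>The double count from the empty set. Its purpose is to bound h / (N^r \<Delta>) by 1 in
  the final argument.\<close>

lemma card_edges_le_max_degree:
  assumes H: "uniform_hypergraph k N H"
  shows "card H * (k choose r) \<le> max_degree r N H * (N choose r)"
proof -
  have "card H * (k choose r) = (\<Sum>T\<in>ksubsets N r. hdegree H T)"
    using sum_hdegree_supersets[OF H, of "{}" 0 r] by (simp add: ksubsets_0 hdegree_def)
  also have "\<dots> \<le> (\<Sum>T\<in>ksubsets N r. max_degree r N H)"
    by (intro sum_mono hdegree_le_max_degree)
  finally show ?thesis by (simp add: card_ksubsets mult.commute)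
qed

text \<open>Up to a binomial factor, d(S) is the mean of the m-degrees over the m-sets containing S,
  and averaging preserves relative error. So near-regularity of order r - 1 controls all lower
  orders with the same \<eta>.\<close>

lemma near_regular_lower:
  assumes H: "uniform_hypergraph k N H" and nr: "near_regular k m \<eta> N H"
    and jm: "j \<le> m" and mk: "m \<le> k" and kN: "k \<le> N" and S: "S \<in> ksubsets N j"
  shows "\<bar>real (hdegree H S) - avg_degree k j N H\<bar> \<le> \<eta> * avg_degree k j N H"
proof -
  let ?I = "{T. T \<in> ksubsets N m \<and> S \<subseteq> T}"
  define A where "A = avg_degree k m N H"
  define c1 c2 where "c1 = real ((k - j) choose (m - j))" and "c2 = real ((N - j) choose (m - j))"
  have c1: "c1 > 0" and c2: "c2 > 0" using jm mk kN by (auto simp: c1_def c2_def)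
  have cI: "real (card ?I) = c2"
  proof -
    have "?I = {T. S \<subseteq> T \<and> T \<subseteq> {1..N} \<and> card T = m}" by (auto simp: ksubsets_def)
    then show ?thesis using card_subsets_between[of "{1..N}" S m] S jm by (simp add: ksubsets_def c2_def)
  qed
  have "real (hdegree H T) \<in> {(1 - \<eta>) * A .. (1 + \<eta>) * A}" if "T \<in> ?I" for T
    using nr that unfolding near_regular_def A_def ksubsets_def by blast
  then have T: "(1 - \<eta>) * A \<le> real (hdegree H T)" "real (hdegree H T) \<le> (1 + \<eta>) * A" if "T \<in> ?I" for T
    using that by auto
  have d: "real (hdegree H S) * c1 = (\<Sum>T\<in>?I. real (hdegree H T))"
    using arg_cong[OF sum_hdegree_supersets[OF H S jm], of real] by (simp add: c1_def)
  have l: "c2 * ((1 - \<eta>) * A) \<le> real (hdegree H S) * c1"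
    unfolding d cI[symmetric] using sum_mono[of ?I "\<lambda>_. (1 - \<eta>) * A"] T(1) by simp
  have u: "real (hdegree H S) * c1 \<le> c2 * ((1 + \<eta>) * A)"
    unfolding d cI[symmetric] using sum_mono[of ?I _ "\<lambda>_. (1 + \<eta>) * A"] T(2) by simp
  \<comment> \<open>The average degrees satisfy exactly the same double-counting relation; this is
    \<open>choose_mult\<close> for \<open>k\<close> and for \<open>N\<close>.\<close>
  have Ac: "c2 * A = avg_degree k j N H * c1"
  proof -
    have k: "real (k choose m) * real (m choose j) = real (k choose j) * c1"
      unfolding c1_def of_nat_mult[symmetric] using choose_mult[OF jm mk] by simp
    have N: "real (N choose m) * real (m choose j) = real (N choose j) * c2"
      unfolding c2_def of_nat_mult[symmetric] using choose_mult[of j m N] jm mk kN by simp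
    have pos: "real (m choose j) > 0" "real (N choose m) > 0" "real (N choose j) > 0" using jm mk kN by auto
    have "c2 * real (k choose m) * real (N choose j) * real (m choose j)
        = c1 * real (k choose j) * real (N choose m) * real (m choose j)"
      using k N by (metis mult.assoc mult.commute)
    then have "c2 * real (k choose m) * real (N choose j) = c1 * real (k choose j) * real (N choose m)"
      using pos by simp
    then have "c2 * real (k choose m) / real (N choose m) = c1 * real (k choose j) / real (N choose j)"
      using pos by (simp add: field_simps)
    then show ?thesis unfolding A_def avg_degree_def
      by (simp add: mult.assoc mult.left_commute[of _ "real (card H)"] flip: times_divide_eq_right) (simp add: mult_ac)
  qed
  have "(1 - \<eta>) * avg_degree k j N H * c1 \<le> real (hdegree H S) * c1"
    using l Ac by (metis mult.assoc mult.commute)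
  then have 1: "(1 - \<eta>) * avg_degree k j N H \<le> real (hdegree H S)" using c1 by simp
  have "real (hdegree H S) * c1 \<le> (1 + \<eta>) * avg_degree k j N H * c1"
    using u Ac by (metis mult.assoc mult.commute)
  then have 2: "real (hdegree H S) \<le> (1 + \<eta>) * avg_degree k j N H" using c1 by simp
  show ?thesis using 1 2 by (simp add: algebra_simps abs_le_iff)
qed

text \<open>Uses (N choose j) \<ge> (N/j)^j, so that average degrees can be compared with powers of
  p N at the price of a constant depending only on k and j.\<close>

lemma avg_degree_le:
  assumes "1 \<le> j" "j \<le> N"
  shows "avg_degree k j N H \<le> real (card H) * (real (k choose j) * real j ^ j) / real N ^ j"
proof -
  have N: "real N / real j > 0" using assms by simp
  have "(real N / real j) ^ j \<le> real (N choose j)" by (rule binomial_ge_n_over_k_pow_k[OF assms(2)])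
  then have "avg_degree k j N H \<le> real (card H) * real (k choose j) / (real N / real j) ^ j"
    unfolding avg_degree_def using N assms by (intro divide_left_mono) (auto intro!: mult_pos_pos)
  then show ?thesis by (simp add: power_divide mult_ac)
qed

section \<open>Moderate deviations of the size\<close>

text \<open>Chernoff's bound with the tilt a / v, optimal for a Gaussian of variance v. The factor 1
  - a / v pays for the cubic term of the moment generating function, so the exponent is sharp when a
  = o(v).\<close>

lemma csum_tail_upper:
  assumes p: "0 \<le> p" "p \<le> 1" and v: "v = real N * (p * (1 - p))" "0 < v" and a: "0 \<le> a" "a \<le> v"
  shows "measure_pmf.prob (random_subset N p) {B. \<bar>csum N p B\<bar> > a} \<le> 2 * exp (- (a\<^sup>2 / (2 * v) * (1 - a / v)))"
proof -
  let ?P = "measure_pmf.prob (random_subset N p)"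
  define u where "u = a / v"
  have u: "0 \<le> u" "u \<le> 1" using a v by (auto simp: u_def)
  have e: "- (u * a) + u\<^sup>2 * v / 2 * (1 + u) = - (a\<^sup>2 / (2 * v) * (1 - a / v))"
    using v(2) by (simp add: u_def field_simps power2_eq_square)
  have *: "?P {B. w * csum N p B > u * a} \<le> exp (- (a\<^sup>2 / (2 * v) * (1 - a / v)))" if w: "\<bar>w\<bar> = u" for w
  proof -
    have "?P {B. w * csum N p B > u * a}
        \<le> exp (- (u * a)) * measure_pmf.expectation (random_subset N p) (\<lambda>B. exp (w * csum N p B))"
      by (rule prob_random_subset_exp_bound)
    also have "\<dots> \<le> exp (- (u * a)) * exp (w\<^sup>2 * v / 2 * (1 + \<bar>w\<bar>))"
      unfolding v(1) using w u by (intro mult_left_mono mgf_csum_le p) auto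
    also have "\<dots> = exp (- (a\<^sup>2 / (2 * v) * (1 - a / v)))"
      unfolding mult_exp_exp e[symmetric] power2_abs[of w, symmetric] w ..
    finally show ?thesis .
  qed
  show ?thesis
  proof (cases "a = 0")
    case True
    then show ?thesis by (simp add: order.trans[OF measure_pmf.prob_le_1])
  next
    case False
    then have u0: "u > 0" using a v by (simp add: u_def)
    have "?P {B. \<bar>csum N p B\<bar> > a} \<le> ?P ({B. u * csum N p B > u * a} \<union> {B. (- u) * csum N p B > u * a})"
    proof (rule prob_random_subset_mono)
      fix B assume "B \<in> {B. \<bar>csum N p B\<bar> > a}"
      then have "a < csum N p B \<or> a < - csum N p B" by auto
      then have "u * a < u * csum N p B \<or> u * a < u * (- csum N p B)"
        using u0 by (metis mult_less_cancel_left_pos)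
      then show "B \<in> {B. u * csum N p B > u * a} \<union> {B. (- u) * csum N p B > u * a}" by auto
    qed
    also have "\<dots> \<le> ?P {B. u * csum N p B > u * a} + ?P {B. (- u) * csum N p B > u * a}"
      by (rule measure_Un_le) auto
    also have "\<dots> \<le> exp (- (a\<^sup>2 / (2 * v) * (1 - a / v))) + exp (- (a\<^sup>2 / (2 * v) * (1 - a / v)))"
      using u by (intro add_mono *) auto
    finally show ?thesis by simp
  qed
qed

text \<open>
  Under the measure tilted by \<open>exp (u * csum N p B)\<close> the sum concentrates in the window
  \<open>(1 \<plusminus> \<beta>) u v\<close>; there the density of the tilt is under control.
\<close>

lemma csum_tail_lower:
  assumes p: "0 \<le> p" "p \<le> 1" and v: "v = real N * (p * (1 - p))"
    and \<beta>: "0 < \<beta>" "\<beta> \<le> 1 / 2" and u: "0 < u" "u \<le> \<beta>\<^sup>2 / 16" and big: "8 \<le> u\<^sup>2 * v * \<beta>\<^sup>2"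
  shows "exp (- (u\<^sup>2 * v / 2 * (1 + 3 * \<beta>))) / 2
     \<le> measure_pmf.prob (random_subset N p) {B. csum N p B > (1 - \<beta>) * u * v}"
proof -
  let ?P = "measure_pmf.prob (random_subset N p)"
  let ?E = "measure_pmf.expectation (random_subset N p)"
  let ?M = "csum N p"
  define G where "G = u\<^sup>2 * v"
  define lo hi where "lo = (1 - \<beta>) * u * v" and "hi = (1 + \<beta>) * u * v"
  have \<beta>2: "\<beta>\<^sup>2 \<le> \<beta> / 2" using \<beta> by (simp add: power2_eq_square)
  have u1: "u \<le> \<beta> / 32" "u \<le> 1 / 64" using u \<beta>2 \<beta> by linarith+
  have v0: "v \<ge> 0" unfolding v using p by simp
  have G0: "G \<ge> 0" unfolding G_def using v0 by simp
  define m where "m = exp (G / 2 * (1 - 2 * u))"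
  have m: "m \<le> ?E (\<lambda>B. exp (u * ?M B))"
    using mgf_csum_ge[OF p, of u N] u1 u unfolding m_def G_def v by simp
  have mgf: "?E (\<lambda>B. exp (w * ?M B)) \<le> exp (w\<^sup>2 * v / 2 * (1 + w))" if "0 \<le> w" "w \<le> 1" for w
    using mgf_csum_le[OF p, of w N] that unfolding v by simp
  \<comment> \<open>The hypothesis \<open>big\<close> makes this exponent at least 2. Consequently
    each of the two tails outside the window takes at most m / 4, and m / 2 remains inside.\<close>
  have e4: "exp (- (G * \<beta>\<^sup>2 / 4)) \<le> 1 / (4::real)"
  proof -
    have "4 \<le> (1 + 2 + 2\<^sup>2 / 2 :: real)" by simp
    also have "\<dots> \<le> exp 2" by (rule exp_lower_Taylor_quadratic) simp
    also have "\<dots> \<le> exp (G * \<beta>\<^sup>2 / 4)" using big by (simp add: G_def)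
    finally show ?thesis by (simp add: exp_minus field_simps)
  qed
  \<comment> \<open>Above \<open>hi\<close> the tilt \<open>u\<close> is dominated by the tilt
    \<open>(1 + \<beta>) * u\<close>, normalised at \<open>hi\<close>, where the latter is centred
    in the Gaussian picture; the gain is \<open>exp (- G * \<beta>\<^sup>2 / 2)\<close> up to cubic
    errors.\<close>
  have upper: "?E (\<lambda>B. exp (u * ?M B) * indicat_real {B. ?M B > hi} B) \<le> m / 4"
  proof -
    have "?E (\<lambda>B. exp (u * ?M B) * indicat_real {B. ?M B > hi} B)
       \<le> ?E (\<lambda>B. exp (- (\<beta> * u * hi)) * exp ((1 + \<beta>) * u * ?M B))"
    proof (rule expectation_random_subset_mono)
      fix B
      have "u * ?M B \<le> - (\<beta> * u * hi) + (1 + \<beta>) * u * ?M B" if "?M B > hi"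
      proof -
        have "\<beta> * u * hi \<le> \<beta> * u * ?M B" using that \<beta> u by simp
        then show ?thesis by (simp add: algebra_simps)
      qed
      then show "exp (u * ?M B) * indicat_real {B. ?M B > hi} B \<le> exp (- (\<beta> * u * hi)) * exp ((1 + \<beta>) * u * ?M B)"
        by (auto simp: indicator_def mult_exp_exp)
    qed
    also have "\<dots> = exp (- (\<beta> * u * hi)) * ?E (\<lambda>B. exp ((1 + \<beta>) * u * ?M B))" by simp
    also have "\<dots> \<le> exp (- (\<beta> * u * hi)) * exp (((1 + \<beta>) * u)\<^sup>2 * v / 2 * (1 + (1 + \<beta>) * u))"
    proof (intro mult_left_mono mgf)
      have "(1 + \<beta>) * u \<le> 2 * u" using \<beta> u by (intro mult_right_mono) auto
      then show "(1 + \<beta>) * u \<le> 1" using u1 by linarith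
    qed (use \<beta> u in auto)
    also have "\<dots> \<le> m * exp (- (G * \<beta>\<^sup>2 / 4))"
      unfolding m_def mult_exp_exp
    proof (subst exp_le_cancel_iff)
      \<comment> \<open>The cubic errors total at most 4 u, and
        \<open>u \<le> \<beta>\<^sup>2 / 16\<close> makes this at most half of the Gaussian gain
        \<open>\<beta>\<^sup>2 / 2\<close>.\<close>
      have "(1 + \<beta>) ^ 3 \<le> (3 / 2) ^ 3" using \<beta> by (intro power_mono) auto
      then have "(1 + \<beta>) ^ 3 * u \<le> 6 * u" using u by (intro mult_right_mono) (auto simp: power3_eq_cube)
      then have "- \<beta>\<^sup>2 / 2 + (1 + \<beta>) ^ 3 * u / 2 + u \<le> - \<beta>\<^sup>2 / 4" using u by linarith
      then have "G * (- \<beta>\<^sup>2 / 2 + (1 + \<beta>) ^ 3 * u / 2 + u) \<le> G * (- \<beta>\<^sup>2 / 4)"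
        using G0 by (rule mult_left_mono)
      moreover have "- (\<beta> * u * hi) + ((1 + \<beta>) * u)\<^sup>2 * v / 2 * (1 + (1 + \<beta>) * u) - G / 2 * (1 - 2 * u)
          = G * (- \<beta>\<^sup>2 / 2 + (1 + \<beta>) ^ 3 * u / 2 + u)"
        by (simp add: hi_def G_def field_simps power2_eq_square power3_eq_cube)
      ultimately show "- (\<beta> * u * hi) + ((1 + \<beta>) * u)\<^sup>2 * v / 2 * (1 + (1 + \<beta>) * u)
          \<le> G / 2 * (1 - 2 * u) + - (G * \<beta>\<^sup>2 / 4)" by simp
    qed
    also have "\<dots> \<le> m * (1 / 4)" using e4 by (intro mult_left_mono) (auto simp: m_def)
    finally show ?thesis by simp
  qed
  have lower: "?E (\<lambda>B. exp (u * ?M B) * indicat_real {B. ?M B \<le> lo} B) \<le> m / 4"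
  proof -
    have "?E (\<lambda>B. exp (u * ?M B) * indicat_real {B. ?M B \<le> lo} B)
       \<le> ?E (\<lambda>B. exp (\<beta> * u * lo) * exp ((1 - \<beta>) * u * ?M B))"
    proof (rule expectation_random_subset_mono)
      fix B
      have "u * ?M B \<le> \<beta> * u * lo + (1 - \<beta>) * u * ?M B" if "?M B \<le> lo"
      proof -
        have "\<beta> * u * ?M B \<le> \<beta> * u * lo" using that \<beta> u by simp
        then show ?thesis by (simp add: algebra_simps)
      qed
      then show "exp (u * ?M B) * indicat_real {B. ?M B \<le> lo} B \<le> exp (\<beta> * u * lo) * exp ((1 - \<beta>) * u * ?M B)"
        by (auto simp: indicator_def mult_exp_exp)
    qed
    also have "\<dots> = exp (\<beta> * u * lo) * ?E (\<lambda>B. exp ((1 - \<beta>) * u * ?M B))" by simp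
    also have "\<dots> \<le> exp (\<beta> * u * lo) * exp (((1 - \<beta>) * u)\<^sup>2 * v / 2 * (1 + (1 - \<beta>) * u))"
    proof (intro mult_left_mono mgf)
      have "(1 - \<beta>) * u \<le> 1 * u" using \<beta> u by (intro mult_right_mono) auto
      then show "(1 - \<beta>) * u \<le> 1" using u1 by linarith
    qed (use \<beta> u in auto)
    also have "\<dots> \<le> m * exp (- (G * \<beta>\<^sup>2 / 4))"
      unfolding m_def mult_exp_exp
    proof (subst exp_le_cancel_iff)
      have "(1 - \<beta>) ^ 3 \<le> 1" using \<beta> by (intro power_le_one) auto
      then have "(1 - \<beta>) ^ 3 * u \<le> 1 * u" using u by (intro mult_right_mono) auto
      then have "- \<beta>\<^sup>2 / 2 + (1 - \<beta>) ^ 3 * u / 2 + u \<le> - \<beta>\<^sup>2 / 4" using u by linarith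
      then have "G * (- \<beta>\<^sup>2 / 2 + (1 - \<beta>) ^ 3 * u / 2 + u) \<le> G * (- \<beta>\<^sup>2 / 4)"
        using G0 by (rule mult_left_mono)
      moreover have "\<beta> * u * lo + ((1 - \<beta>) * u)\<^sup>2 * v / 2 * (1 + (1 - \<beta>) * u) - G / 2 * (1 - 2 * u)
          = G * (- \<beta>\<^sup>2 / 2 + (1 - \<beta>) ^ 3 * u / 2 + u)"
        by (simp add: lo_def G_def field_simps power2_eq_square power3_eq_cube)
      ultimately show "\<beta> * u * lo + ((1 - \<beta>) * u)\<^sup>2 * v / 2 * (1 + (1 - \<beta>) * u)
          \<le> G / 2 * (1 - 2 * u) + - (G * \<beta>\<^sup>2 / 4)" by simp
    qed
    also have "\<dots> \<le> m * (1 / 4)" using e4 by (intro mult_left_mono) (auto simp: m_def)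
    finally show ?thesis by simp
  qed
  \<comment> \<open>The tilted mass is cut at \<open>lo\<close> and \<open>hi\<close>; between them
    the density of the tilt is at most \<open>exp (u * hi)\<close>.\<close>
  have "?E (\<lambda>B. exp (u * ?M B)) \<le> ?E (\<lambda>B. exp (u * ?M B) * indicat_real {B. ?M B > hi} B
      + exp (u * ?M B) * indicat_real {B. ?M B \<le> lo} B + exp (u * hi) * indicat_real {B. ?M B > lo} B)"
    by (rule expectation_random_subset_mono) (use u in \<open>auto simp: indicator_def\<close>)
  also have "\<dots> = ?E (\<lambda>B. exp (u * ?M B) * indicat_real {B. ?M B > hi} B)
      + ?E (\<lambda>B. exp (u * ?M B) * indicat_real {B. ?M B \<le> lo} B) + exp (u * hi) * ?P {B. ?M B > lo}"
    unfolding prob_eq_expectation_indicator by simp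
  finally have "m / 2 \<le> exp (u * hi) * ?P {B. ?M B > lo}" using m upper lower by linarith
  then have "m / 2 * exp (- (u * hi)) \<le> ?P {B. ?M B > lo}"
    by (simp add: exp_minus field_simps)
  moreover have "exp (- (G / 2 * (1 + 3 * \<beta>))) \<le> m * exp (- (u * hi))"
    unfolding m_def mult_exp_exp
  proof (subst exp_le_cancel_iff)
    have "G * (2 * \<beta> + 2 * u) \<le> G * (3 * \<beta>)" using G0 u1 \<beta> by (intro mult_left_mono) auto
    moreover have "G / 2 * (1 - 2 * u) + - (u * hi) = - (G / 2 * (1 + 2 * \<beta> + 2 * u))"
      by (simp add: hi_def G_def field_simps power2_eq_square)
    ultimately show "- (G / 2 * (1 + 3 * \<beta>)) \<le> G / 2 * (1 - 2 * u) + - (u * hi)"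
      by (simp add: algebra_simps)
  qed
  ultimately show ?thesis by (simp add: G_def lo_def)
qed

section \<open>The linear approximation of the deviation\<close>

text \<open>A union bound whose threshold may contain a term depending on \<open>B\<close>. This
  lets terms that are not yet estimated stay on the side of the threshold.\<close>

lemma prob_abs_gt_sum_le:
  fixes f c :: "nat set \<Rightarrow> real" and g :: "'i \<Rightarrow> nat set \<Rightarrow> real"
  assumes "finite I" "\<And>B. B \<subseteq> {1..N} \<Longrightarrow> \<bar>f B\<bar> \<le> (\<Sum>i\<in>I. \<bar>g i B\<bar>) + c B"
  shows "measure_pmf.prob (random_subset N p) {B. \<bar>f B\<bar> > (\<Sum>i\<in>I. b i) + c B}
     \<le> (\<Sum>i\<in>I. measure_pmf.prob (random_subset N p) {B. \<bar>g i B\<bar> > b i})"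
proof -
  have "measure_pmf.prob (random_subset N p) {B. \<bar>f B\<bar> > (\<Sum>i\<in>I. b i) + c B}
     \<le> measure_pmf.prob (random_subset N p) (\<Union>i\<in>I. {B. \<bar>g i B\<bar> > b i})"
  proof (rule prob_random_subset_mono)
    fix B assume B: "B \<subseteq> {1..N}" "B \<in> {B. \<bar>f B\<bar> > (\<Sum>i\<in>I. b i) + c B}"
    then have "\<not> (\<Sum>i\<in>I. \<bar>g i B\<bar>) \<le> (\<Sum>i\<in>I. b i)" using assms(2)[of B] by auto
    then obtain i where "i \<in> I" "\<not> \<bar>g i B\<bar> \<le> b i" using sum_mono by metis
    then show "B \<in> (\<Union>i\<in>I. {B. \<bar>g i B\<bar> > b i})" by (force simp: not_le)
  qed
  also have "\<dots> \<le> (\<Sum>i\<in>I. measure_pmf.prob (random_subset N p) {B. \<bar>g i B\<bar> > b i})"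
    using assms(1) by (intro measure_UNION_le) auto
  finally show ?thesis .
qed

lemma sum_powers_le:
  fixes x :: real
  assumes "2 \<le> x"
  shows "(\<Sum>i<j. x ^ i) \<le> x ^ j"
proof (induction j)
  case (Suc j)
  have "x ^ j + x ^ j \<le> x * x ^ j" using assms by simp
  then show ?case using Suc by simp
qed simp

text \<open>A chaos of order j has size q^j with q = 2 sqrt (p N t) = y p N; measured against L this
  leaves y^j, and Q is chosen so that \<Delta> q^r = L y^r / Q. The \<open>esym\<close> terms remain
  in the random threshold, to be estimated only where \<open>csum\<close> is known to be
  small.\<close>

lemma linear_approximation_tail:
  fixes k r N :: nat and H :: "nat set set" and p \<eta> t y Q :: real
  defines "L \<equiv> p ^ k * real (card H)"
    and "A \<equiv> (\<lambda>j. real (k choose j) * real j ^ j)"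
  assumes H: "uniform_hypergraph k N H" and nr: "near_regular k (r - 1) \<eta> N H" and \<eta>: "0 \<le> \<eta>"
    and r: "2 \<le> r" "r \<le> k" "k \<le> N" and p: "0 < p" "p \<le> 1" and h: "0 < card H"
    and t: "0 \<le> t" "t \<le> p * real N"
    and y: "y = 2 * sqrt (t / (p * real N))"
    and Q: "Q = p ^ (k - r) * real (card H) / (real N ^ r * real (max_degree r N H))"
  shows "measure_pmf.prob (random_subset N p)
     {B. \<bar>deviation k H p B - real k * L / (p * real N) * csum N p B\<bar>
          > L * (\<eta> * (\<Sum>j=1..<r. A j * y ^ j) + y ^ r / Q + (\<Sum>j=2..<r. A j * \<bar>esym N j p B\<bar> / (p * real N) ^ j))}
     \<le> 2 * real r * real N ^ r * exp (- t)"
proof -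
  let ?P = "measure_pmf.prob (random_subset N p)"
  have N: "2 \<le> N" "0 < real N" using r by auto
  define n where "n = p * real N"
  have n: "n > 0" unfolding n_def using p N by simp
  have L: "L > 0" unfolding L_def using p h by simp
  define q where "q = 2 * sqrt (p * real N * t)"
  have q: "q = y * n" "0 \<le> q" "0 \<le> y"
  proof -
    have "sqrt (n * t) = sqrt (n\<^sup>2 * (t / n))" using n by (simp add: power2_eq_square)
    then have "sqrt (n * t) = n * sqrt (t / n)" using n by (simp only: real_sqrt_mult real_sqrt_abs abs_of_pos)
    then show "q = y * n" by (simp add: q_def y n_def mult.assoc)
    show "0 \<le> q" "0 \<le> y" using n t p by (simp_all add: q_def y)
  qed
  define av where "av j = avg_degree k j N H" for j
  have av0: "0 \<le> av j" for j by (simp add: av_def avg_degree_def)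
  have av: "p ^ (k - j) * av j * z \<le> L * (A j * z / n ^ j)" if "1 \<le> j" "j \<le> r" "0 \<le> z" for j z
  proof -
    have "p ^ (k - j) * av j \<le> p ^ (k - j) * (real (card H) * (real (k choose j) * real j ^ j) / real N ^ j)"
      unfolding av_def using that r p by (intro mult_left_mono avg_degree_le) auto
    also have "\<dots> = L * A j / n ^ j"
    proof -
      have "p ^ k = p ^ (k - j) * p ^ j" using that r by (simp flip: power_add)
      then show ?thesis using p by (simp add: L_def A_def n_def power_mult_distrib)
    qed
    finally have "p ^ (k - j) * av j * z \<le> L * A j / n ^ j * z" using that(3) by (rule mult_right_mono)
    then show ?thesis by simp
  qed
  \<comment> \<open>For j < r the irregularity error of order j, for j = r the unexpanded remainder;
    both have coefficients admissible for \<open>chaos_tail\<close>.\<close>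
  define W where "W j B = (if j < r then \<Sum>S\<in>ksubsets N j. (p ^ (k - j) * (real (hdegree H S) - av j)) * cprod p S B
       else \<Sum>S\<in>ksubsets N r. tail_coeff p H S B * cprod p S B)" for j B
  define b where "b j = (if j < r then p ^ (k - j) * (\<eta> * av j) else real (max_degree r N H))" for j
  have W: "?P {B. \<bar>W j B\<bar> > b j * q ^ j} \<le> 2 * real N ^ r * exp (- t)" if j: "j \<in> {1..r}" for j
  proof -
    have "?P {B. \<bar>W j B\<bar> > b j * q ^ j} \<le> 2 * (\<Sum>i<j. real N ^ i) * exp (- t)"
    proof (cases "j < r")
      case True
      have "?P {B. \<bar>\<Sum>S\<in>ksubsets N j. (p ^ (k - j) * (real (hdegree H S) - av j)) * cprod p S B\<bar>
          > p ^ (k - j) * (\<eta> * av j) * q ^ j} \<le> 2 * (\<Sum>i<j. real N ^ i) * exp (- t)"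
        unfolding q_def
      proof (rule chaos_tail)
        fix S assume S: "S \<in> ksubsets N j"
        have "\<bar>real (hdegree H S) - av j\<bar> \<le> \<eta> * av j"
          unfolding av_def using True r by (intro near_regular_lower[OF H nr _ _ _ S]) auto
        then show "\<bar>p ^ (k - j) * (real (hdegree H S) - av j)\<bar> \<le> p ^ (k - j) * (\<eta> * av j)"
          unfolding abs_mult using p by (simp add: mult_left_mono)
      qed (use p t \<eta> av0 in auto)
      then show ?thesis using True by (simp add: W_def b_def)
    next
      case False
      then have jr: "j = r" using j by auto
      have "?P {B. \<bar>\<Sum>S\<in>ksubsets N r. tail_coeff p H S B * cprod p S B\<bar>
          > real (max_degree r N H) * q ^ r} \<le> 2 * (\<Sum>i<r. real N ^ i) * exp (- t)"
        unfolding q_def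
      proof (rule chaos_tail)
        fix S B assume S: "S \<in> ksubsets N r"
        show "\<bar>tail_coeff p H S B\<bar> \<le> real (max_degree r N H)"
          using tail_coeff_bounds[of p H S B] hdegree_le_max_degree[OF S, of H] p by linarith
      qed (use p t tail_coeff_adapted in auto)
      then show ?thesis using jr by (simp add: W_def b_def)
    qed
    also have "\<dots> \<le> 2 * real N ^ r * exp (- t)"
    proof -
      have "(\<Sum>i<j. real N ^ i) \<le> real N ^ j" using N by (intro sum_powers_le) simp
      also have "\<dots> \<le> real N ^ r" using N j by (intro power_increasing) auto
      finally show ?thesis by simp
    qed
    finally show ?thesis .
  qed
  define R where "R B = (\<Sum>j=2..<r. p ^ (k - j) * av j * \<bar>esym N j p B\<bar>)" for B
  define D where "D B = deviation k H p B - real k * L / (p * real N) * csum N p B" for B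
  have split: "{1..r} = insert r {1..<r}" "{1..<r} = insert 1 {2..<r}" using r by auto
  have D_eq: "D B = (\<Sum>j\<in>{1..r}. W j B) + (\<Sum>j=2..<r. p ^ (k - j) * av j * esym N j p B)" for B
  proof -
    \<comment> \<open>The average 1-degree is k h / N, so the regular part of order 1 is exactly the
      linear term that is subtracted.\<close>
    have av1: "p ^ (k - 1) * av 1 = real k * L / (p * real N)"
    proof -
      have "p ^ k = p * p ^ (k - 1)" using r by (metis Suc_diff_1 gr0I le_zero_eq not_numeral_le_zero power_Suc)
      then show ?thesis using p N by (simp add: av_def avg_degree_def L_def)
    qed
    have "p ^ (k - j) * (\<Sum>S\<in>ksubsets N j. real (hdegree H S) * cprod p S B)
        = W j B + p ^ (k - j) * av j * esym N j p B" if "j < r" for j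
      using that by (simp add: W_def esym_def sum_distrib_left sum.distrib[symmetric] algebra_simps)
    then have "(\<Sum>j=1..<r. p ^ (k - j) * (\<Sum>S\<in>ksubsets N j. real (hdegree H S) * cprod p S B))
        = (\<Sum>j=1..<r. W j B + p ^ (k - j) * av j * esym N j p B)" by simp
    then have "deviation k H p B = (\<Sum>j=1..<r. W j B + p ^ (k - j) * av j * esym N j p B) + W r B"
      using deviation_expansion[OF H, of r p B] r by (simp add: W_def)
    also have "\<dots> = (\<Sum>j\<in>{1..r}. W j B) + (\<Sum>j=1..<r. p ^ (k - j) * av j * esym N j p B)"
      unfolding split(1) by (simp add: sum.distrib)
    also have "(\<Sum>j=1..<r. p ^ (k - j) * av j * esym N j p B)
        = p ^ (k - 1) * av 1 * csum N p B + (\<Sum>j=2..<r. p ^ (k - j) * av j * esym N j p B)"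
      unfolding split(2) by (simp add: esym_1)
    finally show ?thesis unfolding D_def av1 by simp
  qed
  have "\<bar>D B\<bar> \<le> (\<Sum>j\<in>{1..r}. \<bar>W j B\<bar>) + R B" for B
  proof -
    have "\<bar>\<Sum>j=2..<r. p ^ (k - j) * av j * esym N j p B\<bar> \<le> R B"
      unfolding R_def by (rule order.trans[OF sum_abs], rule sum_mono) (use p av0 in \<open>simp add: abs_mult\<close>)
    then show ?thesis
      unfolding D_eq using sum_abs[of "\<lambda>j. W j B" "{1..r}"] by linarith
  qed
  then have main: "?P {B. \<bar>D B\<bar> > (\<Sum>j\<in>{1..r}. b j * q ^ j) + R B} \<le> (\<Sum>j\<in>{1..r}. ?P {B. \<bar>W j B\<bar> > b j * q ^ j})"
    by (intro prob_abs_gt_sum_le) auto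
  have bq: "(\<Sum>j\<in>{1..r}. b j * q ^ j) \<le> L * (\<eta> * (\<Sum>j=1..<r. A j * y ^ j) + y ^ r / Q)"
  proof -
    have "(\<Sum>j=1..<r. b j * q ^ j) \<le> (\<Sum>j=1..<r. L * (\<eta> * (A j * y ^ j)))"
    proof (rule sum_mono)
      fix j assume j: "j \<in> {1..<r}"
      have "b j * q ^ j = p ^ (k - j) * av j * (\<eta> * q ^ j)" using j by (simp add: b_def)
      also have "\<dots> \<le> L * (A j * (\<eta> * q ^ j) / n ^ j)" using j \<eta> q by (intro av) auto
      also have "\<dots> = L * (\<eta> * (A j * y ^ j))" using n by (simp add: q(1) power_mult_distrib)
      finally show "b j * q ^ j \<le> L * (\<eta> * (A j * y ^ j))" .
    qed
    moreover have "b r * q ^ r = L * (y ^ r / Q)"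
    proof -
      have "p ^ k = p ^ (k - r) * p ^ r" using r by (simp flip: power_add)
      then show ?thesis using p h N by (simp add: b_def q(1) Q L_def n_def power_mult_distrib)
    qed
    ultimately show ?thesis unfolding split(1) by (simp add: sum_distrib_left ring_distribs)
  qed
  have Rb: "R B \<le> L * (\<Sum>j=2..<r. A j * \<bar>esym N j p B\<bar> / (p * real N) ^ j)" for B
    unfolding R_def sum_distrib_left n_def[symmetric] by (intro sum_mono av) auto
  have "?P {B. \<bar>D B\<bar> > L * (\<eta> * (\<Sum>j=1..<r. A j * y ^ j) + y ^ r / Q
          + (\<Sum>j=2..<r. A j * \<bar>esym N j p B\<bar> / (p * real N) ^ j))}
     \<le> ?P {B. \<bar>D B\<bar> > (\<Sum>j\<in>{1..r}. b j * q ^ j) + R B}"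
  proof (rule prob_random_subset_mono)
    fix B assume B: "B \<in> {B. \<bar>D B\<bar> > L * (\<eta> * (\<Sum>j=1..<r. A j * y ^ j) + y ^ r / Q
          + (\<Sum>j=2..<r. A j * \<bar>esym N j p B\<bar> / (p * real N) ^ j))}"
    then show "B \<in> {B. \<bar>D B\<bar> > (\<Sum>j\<in>{1..r}. b j * q ^ j) + R B}"
      using bq Rb[of B] unfolding mem_Collect_eq ring_distribs(1) by linarith
  qed
  also have "\<dots> \<le> (\<Sum>j\<in>{1..r}. 2 * real N ^ r * exp (- t))"
    by (rule order.trans[OF main], rule sum_mono, rule W)
  finally show ?thesis by (simp add: D_def mult_ac)
qed

section \<open>Asymptotics\<close>

lemma tendsto_zero_power_cancel:
  fixes f :: "nat \<Rightarrow> real"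
  assumes n: "0 < n" and nn: "\<forall>\<^sub>F N in sequentially. 0 \<le> f N" and lim: "(\<lambda>N. f N ^ n) \<longlonglongrightarrow> 0"
  shows "f \<longlonglongrightarrow> 0"
proof -
  have "(\<lambda>N. root n (f N ^ n)) \<longlonglongrightarrow> root n 0" by (rule tendsto_real_root[OF lim])
  moreover have "\<forall>\<^sub>F N in sequentially. root n (f N ^ n) = f N"
    using nn by eventually_elim (use n in \<open>simp add: real_root_power_cancel\<close>)
  ultimately show ?thesis using n by (simp add: Lim_transform_eventually)
qed

lemma power_add_le_two:
  fixes a b :: real
  assumes "0 \<le> a" "0 \<le> b"
  shows "(a + b) ^ n \<le> 2 ^ n * (a ^ n + b ^ n)"
proof -
  have "(a + b) ^ n \<le> (2 * max a b) ^ n" using assms by (intro power_mono) auto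
  also have "\<dots> = 2 ^ n * max a b ^ n" by (simp add: power_mult_distrib)
  also have "\<dots> \<le> 2 ^ n * (a ^ n + b ^ n)" using assms by (intro mult_left_mono) (auto simp: max_def)
  finally show ?thesis .
qed

text \<open>With t = K \<delta>^2 p N + r ln N the factor N^r of the tail bound cancels, and y \<le>
  C (\<delta> + x). \<open>E1\<close> collects the chaos errors, and \<open>E2\<close> bounds the
  \<open>esym\<close> terms outside the event \<open>Bad2\<close> that \<open>csum\<close> is too
  large; both are o(\<delta>).\<close>

lemma linear_approximation_eventually:
  fixes k r :: nat and H :: "nat \<Rightarrow> nat set set" and \<eta> p \<delta> x Q :: "nat \<Rightarrow> real" and K \<epsilon> :: real
  assumes H: "\<And>N. uniform_hypergraph k N (H N)" and nr: "\<And>N. near_regular k (r - 1) (\<eta> N) N (H N)"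
    and \<eta>: "\<And>N. 0 \<le> \<eta> N" and r: "2 \<le> r" "r \<le> k" and p1: "\<And>N. p N \<le> 1"
    and p0: "\<forall>\<^sub>F N in sequentially. 0 < p N" and h0: "\<forall>\<^sub>F N in sequentially. 0 < card (H N)"
    and d0: "\<forall>\<^sub>F N in sequentially. 0 < \<delta> N"
    and x: "\<And>N. x N = sqrt (ln (real N) / (p N * real N))"
    and Q: "\<And>N. Q N = p N ^ (k - r) * real (card (H N)) / (real N ^ r * real (max_degree r N (H N)))"
    and Q0: "\<forall>\<^sub>F N in sequentially. 0 < Q N"
    and \<delta>lim: "\<delta> \<longlonglongrightarrow> 0" and \<Lambda>lim: "filterlim (\<lambda>N. \<delta> N ^ 2 * (p N * real N)) at_top sequentially"
    and xlim: "x \<longlonglongrightarrow> 0" and \<eta>lim: "\<eta> \<longlonglongrightarrow> 0" and \<eta>xlim: "(\<lambda>N. \<eta> N * x N / \<delta> N) \<longlonglongrightarrow> 0"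
    and \<delta>Qlim: "(\<lambda>N. \<delta> N ^ (r - 1) / Q N) \<longlonglongrightarrow> 0" and xQlim: "(\<lambda>N. x N ^ r / (Q N * \<delta> N)) \<longlonglongrightarrow> 0"
    and K: "0 < K" and \<epsilon>: "0 < \<epsilon>"
  shows "\<forall>\<^sub>F N in sequentially. measure_pmf.prob (random_subset N (p N))
     {B. \<bar>deviation k (H N) (p N) B
           - real k * (p N ^ k * real (card (H N))) / (p N * real N) * csum N (p N) B\<bar>
          > \<epsilon> * \<delta> N * (p N ^ k * real (card (H N)))}
     \<le> (2 * real r + 2) * exp (- (K * (\<delta> N ^ 2 * (p N * real N))))"
proof -
  define A where "A j = real (k choose j) * real j ^ j" for j
  \<comment> \<open>From sqrt (t / n) \<le> sqrt K \<delta> + sqrt r x, doubled as in the definition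
    of y.\<close>
  define C where "C = 2 * (sqrt K + sqrt (real r))"
  have A0: "0 \<le> A j" for j by (simp add: A_def)
  have C0: "0 \<le> C" using K by (simp add: C_def)
  have "\<forall>j. \<exists>D\<ge>0. \<forall>N p B a. 0 \<le> p \<longrightarrow> p \<le> 1 \<longrightarrow> 1 \<le> a \<longrightarrow> p * real N \<le> a\<^sup>2 \<longrightarrow>
      \<bar>csum N p B\<bar> \<le> (2 * sqrt K) * a \<longrightarrow> \<bar>esym N j p B\<bar> \<le> D * a ^ j"
    using K by (intro allI esym_bound) auto
  from choice[OF this] obtain D where D: "\<forall>j. 0 \<le> D j \<and> (\<forall>N p B a. 0 \<le> p \<longrightarrow> p \<le> 1 \<longrightarrow> 1 \<le> a
      \<longrightarrow> p * real N \<le> a\<^sup>2 \<longrightarrow> \<bar>csum N p B\<bar> \<le> (2 * sqrt K) * a \<longrightarrow> \<bar>esym N j p B\<bar> \<le> D j * a ^ j)"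
    by (elim exE)
  note Db = D[THEN spec, THEN conjunct2, rule_format]
  define z where "z N = C * (\<delta> N + x N)" for N
  define E1 where "E1 N = \<eta> N * (\<Sum>j=1..<r. A j * z N ^ j) + z N ^ r / Q N" for N
  define E2 where "E2 N = (\<Sum>j=2..<r. A j * (D j * \<delta> N ^ j))" for N
  have zlim: "z \<longlonglongrightarrow> 0"
  proof -
    have "(\<lambda>N. C * (\<delta> N + x N)) \<longlonglongrightarrow> C * (0 + 0)"
      by (intro tendsto_intros \<delta>lim xlim)
    then show ?thesis by (simp add: z_def[abs_def])
  qed
  have E1lim: "(\<lambda>N. E1 N / \<delta> N) \<longlonglongrightarrow> 0"
  proof -
    \<comment> \<open>One factor z is paired with \<eta> / \<delta>; any further powers of z only
      help, as z tends to 0.\<close>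
    have a: "(\<lambda>N. \<eta> N * z N / \<delta> N) \<longlonglongrightarrow> 0"
    proof -
      have "(\<lambda>N. C * (\<eta> N + \<eta> N * x N / \<delta> N)) \<longlonglongrightarrow> C * (0 + 0)"
        by (intro tendsto_intros \<eta>lim \<eta>xlim)
      moreover have "\<forall>\<^sub>F N in sequentially. C * (\<eta> N + \<eta> N * x N / \<delta> N) = \<eta> N * z N / \<delta> N"
        using d0 by eventually_elim (simp add: z_def field_simps)
      ultimately show ?thesis by (simp add: Lim_transform_eventually)
    qed
    have "(\<lambda>N. \<Sum>j=1..<r. A j * (\<eta> N * z N / \<delta> N * z N ^ (j - 1))) \<longlonglongrightarrow> (\<Sum>j=1..<r. A j * (0 * 0 ^ (j - 1)))"
      by (intro tendsto_intros a zlim)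
    then have b: "(\<lambda>N. \<Sum>j=1..<r. A j * (\<eta> N * z N / \<delta> N * z N ^ (j - 1))) \<longlonglongrightarrow> 0" by simp
    have c: "(\<lambda>N. z N ^ r / (Q N * \<delta> N)) \<longlonglongrightarrow> 0"
    proof (rule tendsto_sandwich[OF _ _ tendsto_const])
      show "(\<lambda>N. (C ^ r * 2 ^ r) * (\<delta> N ^ (r - 1) / Q N + x N ^ r / (Q N * \<delta> N))) \<longlonglongrightarrow> 0"
        using tendsto_mult_left[OF tendsto_add[OF \<delta>Qlim xQlim], of "C ^ r * 2 ^ r"] by simp
      have x0: "\<forall>\<^sub>F N in sequentially. 0 \<le> x N"
        using eventually_ge_at_top[of 1] p0 by eventually_elim (simp add: x)
      show "\<forall>\<^sub>F N in sequentially. 0 \<le> z N ^ r / (Q N * \<delta> N)"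
        using x0 d0 Q0 by eventually_elim (use C0 in \<open>simp add: z_def\<close>)
      show "\<forall>\<^sub>F N in sequentially. z N ^ r / (Q N * \<delta> N)
          \<le> (C ^ r * 2 ^ r) * (\<delta> N ^ (r - 1) / Q N + x N ^ r / (Q N * \<delta> N))"
        using x0 d0 Q0
      proof eventually_elim
        case (elim N)
        have "z N ^ r \<le> C ^ r * (2 ^ r * (\<delta> N ^ r + x N ^ r))"
          unfolding z_def power_mult_distrib using elim C0 by (intro mult_left_mono power_add_le_two) auto
        then have "z N ^ r / (Q N * \<delta> N) \<le> C ^ r * (2 ^ r * (\<delta> N ^ r + x N ^ r)) / (Q N * \<delta> N)"
          using elim by (intro divide_right_mono) auto
        also have "\<delta> N ^ r = \<delta> N ^ (r - 1) * \<delta> N"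
          using r by (simp flip: power_Suc2)
        also have "C ^ r * (2 ^ r * (\<delta> N ^ (r - 1) * \<delta> N + x N ^ r)) / (Q N * \<delta> N)
           = (C ^ r * 2 ^ r) * (\<delta> N ^ (r - 1) / Q N + x N ^ r / (Q N * \<delta> N))"
          using elim by (simp add: field_simps)
        finally show ?case .
      qed
    qed
    have "(\<lambda>N. (\<Sum>j=1..<r. A j * (\<eta> N * z N / \<delta> N * z N ^ (j - 1))) + z N ^ r / (Q N * \<delta> N)) \<longlonglongrightarrow> 0"
      using tendsto_add[OF b c] by simp
    moreover have "(\<Sum>j=1..<r. A j * (\<eta> N * z N / \<delta> N * z N ^ (j - 1))) + z N ^ r / (Q N * \<delta> N) = E1 N / \<delta> N" for N
    proof -
      have "A j * (\<eta> N * z N / \<delta> N * z N ^ (j - 1)) = \<eta> N * (A j * z N ^ j) / \<delta> N" if "j \<in> {1..<r}" for j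
      proof -
        have "z N ^ j = z N * z N ^ (j - 1)" using that by (simp flip: power_Suc)
        then show ?thesis by simp
      qed
      then have "(\<Sum>j=1..<r. A j * (\<eta> N * z N / \<delta> N * z N ^ (j - 1))) = \<eta> N * (\<Sum>j=1..<r. A j * z N ^ j) / \<delta> N"
        unfolding sum_distrib_left sum_divide_distrib by (rule sum.cong[OF refl])
      then show ?thesis by (simp add: E1_def add_divide_distrib)
    qed
    ultimately show ?thesis by simp
  qed
  have E2lim: "(\<lambda>N. E2 N / \<delta> N) \<longlonglongrightarrow> 0"
  proof -
    have "(\<lambda>N. \<Sum>j=2..<r. A j * (D j * \<delta> N ^ (j - 1))) \<longlonglongrightarrow> (\<Sum>j=2..<r. A j * (D j * 0 ^ (j - 1)))"
      by (intro tendsto_intros \<delta>lim)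
    moreover have "(\<Sum>j=2..<r. A j * (D j * 0 ^ (j - 1))) = 0" by (intro sum.neutral) auto
    moreover have "\<forall>\<^sub>F N in sequentially. (\<Sum>j=2..<r. A j * (D j * \<delta> N ^ (j - 1))) = E2 N / \<delta> N"
      using d0
    proof eventually_elim
      case (elim N)
      have "A j * (D j * \<delta> N ^ (j - 1)) = A j * (D j * \<delta> N ^ j) / \<delta> N" if "j \<in> {2..<r}" for j
      proof -
        have "\<delta> N ^ j = \<delta> N * \<delta> N ^ (j - 1)" using that by (simp flip: power_Suc)
        then show ?thesis using elim by simp
      qed
      then show ?case unfolding E2_def sum_divide_distrib by (rule sum.cong[OF refl])
    qed
    ultimately show ?thesis by (simp add: Lim_transform_eventually)
  qed
  have ev1: "\<forall>\<^sub>F N in sequentially. E1 N / \<delta> N < \<epsilon> / 2" and ev2: "\<forall>\<^sub>F N in sequentially. E2 N / \<delta> N < \<epsilon> / 2"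
    using \<epsilon> by (auto intro!: order_tendstoD(2)[OF E1lim] order_tendstoD(2)[OF E2lim] simp del: less_divide_eq_numeral1)
  \<comment> \<open>The left side is t / (p N); the tail bounds require t \<le> p N.\<close>
  have ev3: "\<forall>\<^sub>F N in sequentially. K * \<delta> N ^ 2 + real r * x N ^ 2 < 1"
  proof -
    have "(\<lambda>N. K * \<delta> N ^ 2 + real r * x N ^ 2) \<longlonglongrightarrow> K * 0 ^ 2 + real r * 0 ^ 2"
      by (intro tendsto_intros \<delta>lim xlim)
    from order_tendstoD(2)[OF this, of 1] show ?thesis by simp
  qed
  have ev4: "\<forall>\<^sub>F N in sequentially. 1 \<le> \<delta> N ^ 2 * (p N * real N)"
    using \<Lambda>lim by (simp add: filterlim_at_top)
  have ev5: "\<forall>\<^sub>F N in sequentially. \<delta> N < 1" using order_tendstoD(2)[OF \<delta>lim] by simp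
  show ?thesis
    using ev1 ev2 ev3 ev4 ev5 p0 h0 d0 Q0 eventually_ge_at_top[of k]
  proof eventually_elim
    case (elim N)
    let ?P = "measure_pmf.prob (random_subset N (p N))"
    define n where "n = p N * real N"
    define L where "L = p N ^ k * real (card (H N))"
    define t where "t = K * (\<delta> N ^ 2 * n) + real r * ln (real N)"
    define y where "y = 2 * sqrt (t / n)"
    have N: "N \<ge> 2" using elim r by simp
    have lnN: "0 \<le> ln (real N)" using N by simp
    have n0: "0 < n" using elim N by (simp add: n_def)
    have L0: "0 < L" using elim by (simp add: L_def)
    have x0: "0 \<le> x N" using lnN n0 by (simp add: x n_def)
    have x2: "x N ^ 2 = ln (real N) / n" using lnN n0 by (simp add: x n_def)
    have tn: "t / n = K * \<delta> N ^ 2 + real r * x N ^ 2"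
      unfolding x2 t_def using n0 by (simp add: field_simps)
    have t0: "0 \<le> t" using K lnN n0 by (simp add: t_def)
    have t1: "t \<le> n" using elim(3) n0 unfolding tn[symmetric] by simp
    have yz: "y \<le> z N"
    proof -
      have "sqrt (t / n) \<le> sqrt (K * \<delta> N ^ 2) + sqrt (real r * x N ^ 2)"
        unfolding tn using K by (intro sqrt_add_le_add_sqrt) auto
      also have "\<dots> = sqrt K * \<delta> N + sqrt (real r) * x N"
        using elim(8) x0 by (simp add: real_sqrt_mult)
      also have "\<dots> \<le> (sqrt K + sqrt (real r)) * (\<delta> N + x N)"
        using K elim(8) x0 by (simp add: algebra_simps)
      finally show ?thesis unfolding y_def z_def C_def mult.assoc by linarith
    qed
    have y0: "0 \<le> y" using t0 n0 by (simp add: y_def)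
    have E1b: "\<eta> N * (\<Sum>j=1..<r. A j * y ^ j) + y ^ r / Q N \<le> E1 N"
      unfolding E1_def using elim(9) y0 yz A0 \<eta>
      by (intro add_mono mult_left_mono sum_mono divide_right_mono power_mono) auto
    define Bad1 where "Bad1 = {B. \<bar>deviation k (H N) (p N) B - real k * L / (p N * real N) * csum N (p N) B\<bar>
          > L * (\<eta> N * (\<Sum>j=1..<r. A j * y ^ j) + y ^ r / Q N
              + (\<Sum>j=2..<r. A j * \<bar>esym N j (p N) B\<bar> / (p N * real N) ^ j))}"
    define Bad2 where "Bad2 = {B. \<bar>csum N (p N) B\<bar> > 2 * sqrt K * (\<delta> N * n)}"
    have "?P Bad1 \<le> 2 * real r * real N ^ r * exp (- t)"
      unfolding Bad1_def A_def L_def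
      using elim r p1 t0 t1 by (intro linear_approximation_tail H nr \<eta> Q) (auto simp: n_def y_def)
    also have "\<dots> = 2 * real r * exp (- (K * (\<delta> N ^ 2 * n)))"
    proof -
      have "exp (real r * ln (real N)) = real N ^ r"
        using N by (simp add: exp_of_nat_mult)
      then have "real N ^ r * exp (- t) = exp (- (K * (\<delta> N ^ 2 * n)))"
        using N by (simp add: t_def exp_diff)
      then show ?thesis by simp
    qed
    finally have b1: "?P Bad1 \<le> 2 * real r * exp (- (K * (\<delta> N ^ 2 * n)))" .
    have b2: "?P Bad2 \<le> 2 * exp (- (K * (\<delta> N ^ 2 * n)))"
    proof -
      have "sqrt (p N * real N * (K * (\<delta> N ^ 2 * n))) = sqrt (K * (\<delta> N * n)\<^sup>2)"
        by (simp add: n_def power2_eq_square mult_ac)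
      also have "\<dots> = sqrt K * (\<delta> N * n)" using elim(8) n0 by (simp add: real_sqrt_mult)
      finally have s: "1 * (2 * sqrt (p N * real N * (K * (\<delta> N ^ 2 * n)))) = 2 * sqrt K * (\<delta> N * n)" by simp
      have "?P {B. \<bar>\<Sum>i=1..N. cbit (p N) i B * 1\<bar> > 1 * (2 * sqrt (p N * real N * (K * (\<delta> N ^ 2 * n))))}
          \<le> 2 * exp (- (K * (\<delta> N ^ 2 * n)))"
      proof (rule adapted_sum_tail_bounded)
        have "0 \<le> real r * ln (real N)" using lnN by simp
        then show "K * (\<delta> N ^ 2 * n) \<le> p N * real N" using t1 unfolding t_def n_def by linarith
      qed (use elim p1 K n0 in auto)
      then show ?thesis unfolding s by (simp add: Bad2_def csum_def)
    qed
    have "?P {B. \<bar>deviation k (H N) (p N) B - real k * L / (p N * real N) * csum N (p N) B\<bar> > \<epsilon> * \<delta> N * L}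
        \<le> ?P (Bad1 \<union> Bad2)"
    proof (rule prob_random_subset_mono)
      fix B assume B: "B \<in> {B. \<bar>deviation k (H N) (p N) B - real k * L / (p N * real N) * csum N (p N) B\<bar> > \<epsilon> * \<delta> N * L}"
      show "B \<in> Bad1 \<union> Bad2"
      proof (cases "B \<in> Bad2")
        case False
        \<comment> \<open>The two size conditions of \<open>esym_bound\<close> for a = \<delta> n.
          Both rest on \<delta>^2 n \<ge> 1, the first one also on \<delta> < 1.\<close>
        have a1: "1 \<le> \<delta> N * n"
        proof -
          have "\<delta> N ^ 2 * n \<le> \<delta> N * n"
            using elim(5,8) n0 by (intro mult_right_mono) (auto simp: power2_eq_square)
          then show ?thesis using elim(4) unfolding n_def by linarith
        qed
        have a2: "p N * real N \<le> (\<delta> N * n)\<^sup>2"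
        proof -
          have "n * 1 \<le> n * (\<delta> N ^ 2 * n)" using elim(4) n0 unfolding n_def by (intro mult_left_mono) auto
          then show ?thesis by (simp add: n_def power2_eq_square mult_ac)
        qed
        have es: "\<bar>esym N j (p N) B\<bar> \<le> D j * (\<delta> N * n) ^ j" for j
          using False elim(6) p1 a1 a2 by (intro Db) (auto simp: Bad2_def not_less)
        have "(\<Sum>j=2..<r. A j * \<bar>esym N j (p N) B\<bar> / (p N * real N) ^ j) \<le> E2 N"
          unfolding E2_def n_def[symmetric]
        proof (rule sum_mono)
          fix j
          have "A j * \<bar>esym N j (p N) B\<bar> / n ^ j \<le> A j * (D j * (\<delta> N * n) ^ j) / n ^ j"
            using A0 n0 by (intro divide_right_mono mult_left_mono es) auto
          also have "\<dots> = A j * (D j * \<delta> N ^ j)" using n0 by (simp add: power_mult_distrib)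
          finally show "A j * \<bar>esym N j (p N) B\<bar> / n ^ j \<le> A j * (D j * \<delta> N ^ j)" .
        qed
        moreover have "E1 N + E2 N \<le> \<epsilon> * \<delta> N"
          using elim(1,2,8) by (simp add: field_simps)
        ultimately have "\<eta> N * (\<Sum>j=1..<r. A j * y ^ j) + y ^ r / Q N
              + (\<Sum>j=2..<r. A j * \<bar>esym N j (p N) B\<bar> / (p N * real N) ^ j) \<le> \<epsilon> * \<delta> N"
          using E1b by linarith
        then have "L * (\<eta> N * (\<Sum>j=1..<r. A j * y ^ j) + y ^ r / Q N
              + (\<Sum>j=2..<r. A j * \<bar>esym N j (p N) B\<bar> / (p N * real N) ^ j)) \<le> L * (\<epsilon> * \<delta> N)"
          using L0 by (intro mult_left_mono) auto
        then show ?thesis using B by (auto simp: Bad1_def mult_ac)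
      qed simp
    qed
    also have "\<dots> \<le> ?P Bad1 + ?P Bad2" by (rule measure_Un_le) auto
    also have "\<dots> \<le> (2 * real r + 2) * exp (- (K * (\<delta> N ^ 2 * n)))"
      using b1 b2 by (simp add: ring_distribs)
    finally show ?case by (simp add: L_def n_def)
  qed
qed

text \<open>In the linear approximation the event is |csum| > \<delta> n / k with n = p N, and
  \<open>csum\<close> has variance v = n (1 - p), so the Gaussian exponent is X. An approximation
  error of \<epsilon> \<delta> L moves this threshold by a factor 1 - \<epsilon> or 1 +
  \<epsilon>.\<close>

lemma moderate_deviation_sandwich:
  fixes k :: nat and p \<delta> L :: "nat \<Rightarrow> real" and F :: "nat \<Rightarrow> nat set \<Rightarrow> real" and c R e :: real
  defines "X \<equiv> (\<lambda>N. \<delta> N ^ 2 * p N * real N / (2 * (real k)\<^sup>2 * (1 - p N)))"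
  assumes k: "1 \<le> k" and c: "c < 1" "\<And>N. p N \<le> c" and p: "\<And>N. 0 \<le> p N" and R: "0 \<le> R"
    and p0: "\<forall>\<^sub>F N in sequentially. 0 < p N" and d0: "\<forall>\<^sub>F N in sequentially. 0 < \<delta> N"
    and L0: "\<forall>\<^sub>F N in sequentially. 0 < L N"
    and \<delta>lim: "\<delta> \<longlonglongrightarrow> 0" and \<Lambda>lim: "filterlim (\<lambda>N. \<delta> N ^ 2 * (p N * real N)) at_top sequentially"
    and approx: "\<And>K \<epsilon>. 0 < K \<Longrightarrow> 0 < \<epsilon> \<Longrightarrow> \<forall>\<^sub>F N in sequentially. measure_pmf.prob (random_subset N (p N))
       {B. \<bar>F N B - real k * L N / (p N * real N) * csum N (p N) B\<bar> > \<epsilon> * \<delta> N * L N}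
        \<le> R * exp (- (K * (\<delta> N ^ 2 * (p N * real N))))"
    and e: "0 < e"
  shows "\<forall>\<^sub>F N in sequentially. 0 < X N \<and>
     exp (- ((1 + e) * X N)) \<le> measure_pmf.prob (random_subset N (p N)) {B. \<bar>F N B\<bar> > \<delta> N * L N} \<and>
     measure_pmf.prob (random_subset N (p N)) {B. \<bar>F N B\<bar> > \<delta> N * L N} \<le> exp (- ((1 - e) * X N))"
proof -
  \<comment> \<open>The losses in the exponent are 4 \<epsilon> above and 21 \<epsilon> below, and
    20 \<epsilon> \<le> 1/2 lets the main lower bound dominate the error exp (-2 X).\<close>
  define \<epsilon> where "\<epsilon> = min e 1 / 42"
  have \<epsilon>: "0 < \<epsilon>" "\<epsilon> \<le> 1 / 42" "42 * \<epsilon> \<le> e" using e by (auto simp: \<epsilon>_def)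
  \<comment> \<open>Since 1 - p \<ge> 1 - c, this K gives K \<delta>^2 n \<ge> 2 X, so the
    approximation fails with probability at most R exp (-2 X).\<close>
  define K where "K = 1 / (1 - c)"
  have K: "0 < K" using c by (simp add: K_def)
  \<comment> \<open>A lower bound for X. In order, the entries absorb the prefactor 2 + R above,
    make the failure probability a quarter of the main term, absorb the remaining factor 1/4, supply
    the largeness condition of \<open>csum_tail_lower\<close>, and make X positive.\<close>
  define T where "T = Max {ln (2 + R) / \<epsilon>, 2 * ln (4 * R + 1), ln 4 / \<epsilon>, 4 / \<epsilon>\<^sup>2, 1}"
  have T: "ln (2 + R) / \<epsilon> \<le> T" "2 * ln (4 * R + 1) \<le> T" "ln 4 / \<epsilon> \<le> T" "4 / \<epsilon>\<^sup>2 \<le> T" "1 \<le> T"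
    by (simp_all add: T_def)
  \<comment> \<open>Gives \<delta> / (1 - p) \<le> \<epsilon>^2 / 32; the tilt u of the lower bound
    is at most twice that quotient, as \<open>csum_tail_lower\<close> demands.\<close>
  have ev1: "\<forall>\<^sub>F N in sequentially. \<delta> N < \<epsilon>\<^sup>2 / 32 * (1 - c)"
    using \<epsilon> c by (intro order_tendstoD(2)[OF \<delta>lim]) simp
  have ev2: "\<forall>\<^sub>F N in sequentially. 2 * (real k)\<^sup>2 * T \<le> \<delta> N ^ 2 * (p N * real N)"
    using \<Lambda>lim by (simp add: filterlim_at_top)
  show ?thesis
    using ev1 ev2 approx[OF K \<epsilon>(1)] p0 d0 L0 eventually_gt_at_top[of 0]
  proof eventually_elim
    case (elim N)
    let ?P = "measure_pmf.prob (random_subset N (p N))"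
    define n where "n = p N * real N"
    define v where "v = real N * (p N * (1 - p N))"
    define q where "q = 1 - p N"
    have q: "1 - c \<le> q" "0 < q" "q \<le> 1" using c(1) c(2)[of N] p[of N] by (auto simp: q_def)
    have n: "0 < n" using elim by (simp add: n_def)
    have vq: "v = n * q" by (simp add: v_def n_def q_def)
    have v: "0 < v" unfolding vq using n q by simp
    have pp: "0 \<le> p N" "p N \<le> 1" using p[of N] c(1) c(2)[of N] by auto
    have k0: "1 \<le> real k" using k by simp
    have XN: "X N = \<delta> N ^ 2 * n / (2 * (real k)\<^sup>2 * q)" by (simp add: X_def n_def q_def mult.assoc)
    have XT: "T \<le> X N"
    proof -
      have "T \<le> \<delta> N ^ 2 * n / (2 * (real k)\<^sup>2)" using elim(2) k0 by (simp add: n_def field_simps)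
      also have "\<dots> \<le> X N" unfolding XN using q k0 n by (intro divide_left_mono) (auto intro!: mult_left_le)
      finally show ?thesis .
    qed
    have X0: "0 < X N" using XT T(5) by linarith
    have K2: "2 * X N \<le> K * (\<delta> N ^ 2 * n)"
    proof -
      have "(1 - c) * 1 \<le> q * (real k)\<^sup>2" using q k0 c by (intro mult_mono) auto
      then have "\<delta> N ^ 2 * n / (q * (real k)\<^sup>2) \<le> \<delta> N ^ 2 * n / (1 - c)"
        using n c q k0 by (intro divide_left_mono) auto
      moreover have "2 * X N = \<delta> N ^ 2 * n / (q * (real k)\<^sup>2)" unfolding XN by (simp add: mult_ac)
      ultimately show ?thesis by (simp add: K_def)
    qed
    define Bad where "Bad = {B. \<bar>F N B - real k * L N / n * csum N (p N) B\<bar> > \<epsilon> * \<delta> N * L N}"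
    have bad: "?P Bad \<le> R * exp (- (2 * X N))"
    proof -
      have "?P Bad \<le> R * exp (- (K * (\<delta> N ^ 2 * n)))" using elim(3) by (simp add: Bad_def n_def)
      also have "\<dots> \<le> R * exp (- (2 * X N))" using R K2 by (intro mult_left_mono) auto
      finally show ?thesis .
    qed
    define w where "w = real k * L N / n"
    have w: "0 < w" using k0 elim(6) n by (simp add: w_def)
    have dq: "\<delta> N / q \<le> \<epsilon>\<^sup>2 / 32"
    proof -
      have "\<delta> N \<le> \<epsilon>\<^sup>2 / 32 * (1 - c)" using elim(1) by simp
      also have "\<dots> \<le> \<epsilon>\<^sup>2 / 32 * q" using q by (intro mult_left_mono) auto
      finally show ?thesis using q by (simp add: field_simps)
    qed
    have \<epsilon>2: "\<epsilon>\<^sup>2 \<le> \<epsilon>" using \<epsilon> by (simp add: power2_eq_square mult_le_cancel_left1)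

    have up: "?P {B. \<bar>F N B\<bar> > \<delta> N * L N} \<le> exp (- ((1 - e) * X N))"
    proof -
      define a where "a = (1 - \<epsilon>) * \<delta> N * n / real k"
      have a0: "0 \<le> a" using \<epsilon> elim(5) n by (simp add: a_def)
      have av: "a / v \<le> \<epsilon>"
      proof -
        have "a / v = (1 - \<epsilon>) / real k * (\<delta> N / q)" unfolding a_def vq using n q k0 by (simp add: field_simps)
        also have "\<dots> \<le> 1 * (\<delta> N / q)"
          using \<epsilon> k0 elim(5) q by (intro mult_right_mono) (auto simp: field_simps)
        finally show ?thesis using dq \<epsilon>2 \<epsilon> by linarith
      qed
      have a2: "a\<^sup>2 / (2 * v) = (1 - \<epsilon>)\<^sup>2 * X N"
        unfolding a_def vq XN using n q k0 by (simp add: field_simps power2_eq_square)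
      have "?P {B. \<bar>F N B\<bar> > \<delta> N * L N} \<le> ?P ({B. \<bar>csum N (p N) B\<bar> > a} \<union> Bad)"
      proof (rule prob_random_subset_mono)
        fix B assume B: "B \<in> {B. \<bar>F N B\<bar> > \<delta> N * L N}"
        show "B \<in> {B. \<bar>csum N (p N) B\<bar> > a} \<union> Bad"
        proof (cases "B \<in> Bad")
          case False
          then have "\<bar>F N B - w * csum N (p N) B\<bar> \<le> \<epsilon> * \<delta> N * L N" by (simp add: Bad_def w_def not_less)
          then have "(1 - \<epsilon>) * (\<delta> N * L N) < \<bar>w * csum N (p N) B\<bar>"
            using B abs_triangle_ineq2[of "F N B" "w * csum N (p N) B"] by (simp add: algebra_simps)
          also have "\<bar>w * csum N (p N) B\<bar> = w * \<bar>csum N (p N) B\<bar>" using w by (simp add: abs_mult)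
          also have "(1 - \<epsilon>) * (\<delta> N * L N) = w * a" using n k0 by (simp add: w_def a_def)
          finally show ?thesis using w by simp
        qed simp
      qed
      also have "\<dots> \<le> ?P {B. \<bar>csum N (p N) B\<bar> > a} + ?P Bad" by (rule measure_Un_le) auto
      also have "\<dots> \<le> 2 * exp (- ((1 - \<epsilon>)\<^sup>2 * X N * (1 - a / v))) + R * exp (- (2 * X N))"
      proof (rule add_mono[OF _ bad])
        have "a / v \<le> 1" using av \<epsilon> by linarith
        then have "a \<le> v" using v by simp
        then show "?P {B. \<bar>csum N (p N) B\<bar> > a} \<le> 2 * exp (- ((1 - \<epsilon>)\<^sup>2 * X N * (1 - a / v)))"
          using csum_tail_upper[OF pp v_def v a0] unfolding a2 by simp
      qed
      also have "\<dots> \<le> 2 * exp (- ((1 - 3 * \<epsilon>) * X N)) + R * exp (- ((1 - 3 * \<epsilon>) * X N))"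
      proof (intro add_mono mult_left_mono)
        have "1 - 3 * \<epsilon> \<le> (1 - \<epsilon>)\<^sup>2 * (1 - \<epsilon>)"
        proof -
          have "(1 - \<epsilon>)\<^sup>2 * (1 - \<epsilon>) = 1 - 3 * \<epsilon> + \<epsilon> * \<epsilon> * (3 - \<epsilon>)" by (simp add: power2_eq_square algebra_simps)
          moreover have "0 \<le> \<epsilon> * \<epsilon> * (3 - \<epsilon>)" using \<epsilon> by (intro mult_nonneg_nonneg) auto
          ultimately show ?thesis by linarith
        qed
        also have "\<dots> \<le> (1 - \<epsilon>)\<^sup>2 * (1 - a / v)" using av by (intro mult_left_mono) auto
        finally have "(1 - 3 * \<epsilon>) * X N \<le> (1 - \<epsilon>)\<^sup>2 * (1 - a / v) * X N" using X0 by (intro mult_right_mono) auto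
        then show "exp (- ((1 - \<epsilon>)\<^sup>2 * X N * (1 - a / v))) \<le> exp (- ((1 - 3 * \<epsilon>) * X N))"
          by (simp add: mult_ac)
        have "(1 - 3 * \<epsilon>) * X N \<le> 2 * X N" using X0 \<epsilon> by (intro mult_right_mono) auto
        then show "exp (- (2 * X N)) \<le> exp (- ((1 - 3 * \<epsilon>) * X N))" by simp
      qed (use R in auto)
      also have "\<dots> = (2 + R) * exp (- ((1 - 3 * \<epsilon>) * X N))" by (simp add: ring_distribs)
      also have "\<dots> \<le> exp (\<epsilon> * X N) * exp (- ((1 - 3 * \<epsilon>) * X N))"
      proof (rule mult_right_mono)
        have "ln (2 + R) \<le> \<epsilon> * X N" using order.trans[OF T(1) XT] \<epsilon> by (simp add: field_simps)
        then have "exp (ln (2 + R)) \<le> exp (\<epsilon> * X N)" by simp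
        then show "2 + R \<le> exp (\<epsilon> * X N)" using R by simp
      qed simp
      also have "\<dots> = exp (- ((1 - 4 * \<epsilon>) * X N))" by (simp add: mult_exp_exp algebra_simps)
      also have "\<dots> \<le> exp (- ((1 - e) * X N))"
      proof -
        have "(1 - e) * X N \<le> (1 - 4 * \<epsilon>) * X N" using X0 \<epsilon> by (intro mult_right_mono) auto
        then show ?thesis by simp
      qed
      finally show ?thesis .
    qed

    have low: "exp (- ((1 + e) * X N)) \<le> ?P {B. \<bar>F N B\<bar> > \<delta> N * L N}"
    proof -
      \<comment> \<open>Chosen so that the lower end (1 - \<epsilon>) u v of the tilted window is (1
        + \<epsilon>) \<delta> n / k. There the linear term is at least (1 + \<epsilon>) \<delta> L,
        which survives the approximation error.\<close>
      define \<rho> where "\<rho> = (1 + \<epsilon>) / (1 - \<epsilon>)"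
      have \<rho>: "1 \<le> \<rho>" "\<rho> \<le> 1 + 3 * \<epsilon>"
      proof -
        show "1 \<le> \<rho>" using \<epsilon> by (simp add: \<rho>_def)
        have "3 * \<epsilon> * \<epsilon> \<le> 1 * \<epsilon>" using \<epsilon> by (intro mult_right_mono) auto
        then have "1 + \<epsilon> \<le> (1 + 3 * \<epsilon>) * (1 - \<epsilon>)" by (simp add: algebra_simps)
        then show "\<rho> \<le> 1 + 3 * \<epsilon>" using \<epsilon> by (simp add: \<rho>_def pos_divide_le_eq)
      qed
      define u where "u = \<rho> * \<delta> N / (real k * q)"
      have u0: "0 < u" using \<rho> elim(5) k0 q by (simp add: u_def)
      have u1: "u \<le> \<epsilon>\<^sup>2 / 16"
      proof -
        have "u = \<rho> / real k * (\<delta> N / q)" by (simp add: u_def)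
        also have "\<dots> \<le> 2 * (\<delta> N / q)"
          using \<rho> \<epsilon> k0 elim(5) q by (intro mult_right_mono) (auto simp: field_simps)
        finally show ?thesis using dq by linarith
      qed
      have uv: "u\<^sup>2 * v = 2 * \<rho>\<^sup>2 * X N"
        unfolding u_def vq XN using q k0 by (simp add: field_simps power2_eq_square)
      have \<rho>2: "1 \<le> \<rho>\<^sup>2" using \<rho> by simp
      have big: "8 \<le> u\<^sup>2 * v * \<epsilon>\<^sup>2"
      proof -
        have "4 \<le> X N * \<epsilon>\<^sup>2" using order.trans[OF T(4) XT] \<epsilon> by (simp add: field_simps)
        moreover have "1 * (X N * \<epsilon>\<^sup>2) \<le> \<rho>\<^sup>2 * (X N * \<epsilon>\<^sup>2)" using \<rho>2 X0 by (intro mult_right_mono) auto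
        ultimately show ?thesis unfolding uv mult.assoc by linarith
      qed
      have lo: "(1 - \<epsilon>) * u * v = (1 + \<epsilon>) * \<delta> N * n / real k"
      proof -
        have "(1 - \<epsilon>) * \<rho> = 1 + \<epsilon>" using \<epsilon> by (simp add: \<rho>_def)
        moreover have "(1 - \<epsilon>) * u * v = ((1 - \<epsilon>) * \<rho>) * \<delta> N * n / real k" using q by (simp add: u_def vq)
        ultimately show ?thesis by simp
      qed
      have exponent: "\<rho>\<^sup>2 * (1 + 3 * \<epsilon>) \<le> 1 + 20 * \<epsilon>"
      proof -
        have "\<rho>\<^sup>2 * (1 + 3 * \<epsilon>) \<le> (1 + 3 * \<epsilon>)\<^sup>2 * (1 + 3 * \<epsilon>)"
          using \<rho> \<epsilon> by (intro mult_right_mono power_mono) auto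
        also have "\<dots> = 1 + 9 * \<epsilon> + (27 * \<epsilon> + 27 * \<epsilon>\<^sup>2) * \<epsilon>" by (simp add: power2_eq_square algebra_simps)
        also have "\<dots> \<le> 1 + 9 * \<epsilon> + 11 * \<epsilon>"
          using \<epsilon> \<epsilon>2 by (intro add_left_mono mult_right_mono) auto
        finally show ?thesis by simp
      qed
      have "exp (- ((1 + 20 * \<epsilon>) * X N)) / 2 \<le> exp (- (u\<^sup>2 * v / 2 * (1 + 3 * \<epsilon>))) / 2"
      proof -
        have "\<rho>\<^sup>2 * (1 + 3 * \<epsilon>) * X N \<le> (1 + 20 * \<epsilon>) * X N" using exponent X0 by (intro mult_right_mono) auto
        then show ?thesis unfolding uv by (simp add: mult_ac)
      qed
      also have "\<dots> \<le> ?P {B. csum N (p N) B > (1 - \<epsilon>) * u * v}"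
        using \<epsilon> by (intro csum_tail_lower pp v_def u0 u1 big) auto
      also have "\<dots> \<le> ?P ({B. \<bar>F N B\<bar> > \<delta> N * L N} \<union> Bad)"
      proof (rule prob_random_subset_mono)
        fix B assume B: "B \<in> {B. csum N (p N) B > (1 - \<epsilon>) * u * v}"
        show "B \<in> {B. \<bar>F N B\<bar> > \<delta> N * L N} \<union> Bad"
        proof (cases "B \<in> Bad")
          case False
          then have "\<bar>F N B - w * csum N (p N) B\<bar> \<le> \<epsilon> * \<delta> N * L N" by (simp add: Bad_def w_def not_less)
          moreover have "w * ((1 + \<epsilon>) * \<delta> N * n / real k) < w * csum N (p N) B"
            using B w unfolding lo mem_Collect_eq by (rule mult_strict_left_mono)
          moreover have "w * ((1 + \<epsilon>) * \<delta> N * n / real k) = \<delta> N * L N + \<epsilon> * \<delta> N * L N"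
            using n k0 by (simp add: w_def algebra_simps add_divide_distrib)
          ultimately show ?thesis by auto
        qed simp
      qed
      also have "\<dots> \<le> ?P {B. \<bar>F N B\<bar> > \<delta> N * L N} + ?P Bad" by (rule measure_Un_le) auto
      finally have main: "exp (- ((1 + 20 * \<epsilon>) * X N)) / 2 - R * exp (- (2 * X N)) \<le> ?P {B. \<bar>F N B\<bar> > \<delta> N * L N}"
        using bad by linarith
      have small: "R * exp (- (2 * X N)) \<le> exp (- ((1 + 20 * \<epsilon>) * X N)) / 4"
      proof -
        have "ln (4 * R + 1) \<le> X N / 2" using order.trans[OF T(2) XT] by simp
        also have "\<dots> \<le> (1 - 20 * \<epsilon>) * X N" using \<epsilon> X0 mult_right_mono[of "1/2" "1 - 20 * \<epsilon>" "X N"] by simp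
        finally have "exp (ln (4 * R + 1)) \<le> exp ((1 - 20 * \<epsilon>) * X N)" by simp
        then have "4 * R \<le> exp ((1 - 20 * \<epsilon>) * X N)" using R by simp
        then have "4 * R * exp (- (2 * X N)) \<le> exp ((1 - 20 * \<epsilon>) * X N) * exp (- (2 * X N))"
          by (intro mult_right_mono) auto
        also have "\<dots> = exp (- ((1 + 20 * \<epsilon>) * X N))" by (simp add: mult_exp_exp algebra_simps)
        finally show ?thesis by simp
      qed
      have "exp (- ((1 + e) * X N)) \<le> exp (- ((1 + 21 * \<epsilon>) * X N))"
      proof -
        have "(1 + 21 * \<epsilon>) * X N \<le> (1 + e) * X N" using X0 \<epsilon> by (intro mult_right_mono) auto
        then show ?thesis by simp
      qed
      also have "\<dots> = exp (- (\<epsilon> * X N)) * exp (- ((1 + 20 * \<epsilon>) * X N))"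
        by (simp add: mult_exp_exp algebra_simps)
      also have "\<dots> \<le> 1 / 4 * exp (- ((1 + 20 * \<epsilon>) * X N))"
      proof (rule mult_right_mono)
        have "ln 4 \<le> \<epsilon> * X N" using order.trans[OF T(3) XT] \<epsilon> by (simp add: field_simps)
        then have "exp (ln 4) \<le> exp (\<epsilon> * X N)" by (subst exp_le_cancel_iff)
        then show "exp (- (\<epsilon> * X N)) \<le> 1 / 4" by (simp add: exp_minus field_simps)
      qed simp
      finally show ?thesis using main small by linarith
    qed
    show ?case using X0 up low by (simp add: n_def)
  qed
qed

text \<open>The sequence is obtained by solving the equation for it. The sandwich with e / 2 places
  it within e / 2 of 0, and the one with e = 1 already makes P and X positive, so that the equation
  holds eventually.\<close>

lemma exponent_from_sandwich:
  fixes P X :: "nat \<Rightarrow> real"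
  assumes "\<And>e. 0 < e \<Longrightarrow> \<forall>\<^sub>F N in sequentially. 0 < X N \<and> exp (- ((1 + e) * X N)) \<le> P N \<and> P N \<le> exp (- ((1 - e) * X N))"
  shows "\<exists>\<epsilon>. \<epsilon> \<longlonglongrightarrow> 0 \<and> (\<forall>\<^sub>F N in sequentially. P N = exp (- (1 + \<epsilon> N) * X N))"
proof (intro exI conjI)
  let ?\<epsilon> = "\<lambda>N. - ln (P N) / X N - 1"
  show "?\<epsilon> \<longlonglongrightarrow> 0"
  proof (rule tendstoI)
    fix e :: real assume "0 < e"
    then have "0 < e / 2" by simp
    from assms[OF this] show "\<forall>\<^sub>F N in sequentially. dist (?\<epsilon> N) 0 < e"
    proof eventually_elim
      case (elim N)
      have P: "0 < P N" using elim exp_gt_zero[of "- ((1 + e / 2) * X N)"] by linarith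
      have "- ((1 + e / 2) * X N) \<le> ln (P N)" using elim P by (simp add: ln_ge_iff)
      moreover have "ln (P N) \<le> - ((1 - e / 2) * X N)"
        using elim P ln_le_cancel_iff[of "P N" "exp (- ((1 - e / 2) * X N))"] by simp
      ultimately have "- ln (P N) / X N \<le> 1 + e / 2" "1 - e / 2 \<le> - ln (P N) / X N"
        using elim by (simp_all only: pos_divide_le_eq pos_le_divide_eq)
      then show ?case using \<open>0 < e\<close> by (simp add: dist_real_def abs_less_iff)
    qed
  qed
  have "(0::real) < 1" by simp
  from assms[OF this] show "\<forall>\<^sub>F N in sequentially. P N = exp (- (1 + ?\<epsilon> N) * X N)"
  proof eventually_elim
    case (elim N)
    have P: "0 < P N" using elim exp_gt_zero[of "- ((1 + 1) * X N)"] by linarith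
    then show ?case using elim by simp
  qed
qed

section \<open>Translation of the hypotheses on \<delta> into limits\<close>

lemma quotient_tendsto_zero_le:
  fixes f g \<delta> :: "nat \<Rightarrow> real"
  assumes "(\<lambda>N. g N / \<delta> N) \<longlonglongrightarrow> 0" "\<forall>\<^sub>F N in sequentially. 0 < \<delta> N"
    "\<forall>\<^sub>F N in sequentially. 0 \<le> f N" "\<And>N. f N \<le> g N"
  shows "(\<lambda>N. f N / \<delta> N) \<longlonglongrightarrow> 0"
proof (rule tendsto_sandwich[OF _ _ tendsto_const assms(1)])
  show "\<forall>\<^sub>F N in sequentially. 0 \<le> f N / \<delta> N"
    using assms(2,3) by eventually_elim simp
  show "\<forall>\<^sub>F N in sequentially. f N / \<delta> N \<le> g N / \<delta> N"
    using assms(2) by eventually_elim (simp add: divide_right_mono assms(4))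
qed

lemma powr_half_eq_sqrt_power: "0 < a \<Longrightarrow> a powr (real n / 2) = sqrt a ^ n"
  by (simp add: powr_half_sqrt[symmetric] powr_powr powr_power mult.commute)

text \<open>Splitting the exponent k - r/2 as (k - r) + r/2 shows that the first entry of the
  maximum is x^r / Q.\<close>

lemma max_degree_term_eq:
  fixes p h \<Delta> :: real and N k r :: nat
  assumes "0 < p" "0 < h" "2 \<le> N" "r \<le> k"
  shows "\<Delta> * (real N * ln (real N)) powr (real r / 2) / (p powr (real k - real r / 2) * h)
    = sqrt (ln (real N) / (p * real N)) ^ r / (p ^ (k - r) * h / (real N ^ r * \<Delta>))"
proof -
  have N: "0 < real N" "0 < ln (real N)" using assms by simp_all
  have 1: "(real N * ln (real N)) powr (real r / 2) = sqrt (real N) ^ r * sqrt (ln (real N)) ^ r"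
    using N by (simp add: powr_half_eq_sqrt_power real_sqrt_mult power_mult_distrib)
  have sq: "sqrt a ^ r * sqrt a ^ r = a ^ r" if "0 < a" for a :: real
    using that by (simp flip: power_mult_distrib)
  have "p powr (real k - real r / 2) = p ^ k / sqrt p ^ r"
    using assms by (simp add: powr_diff powr_half_eq_sqrt_power powr_realpow)
  also have "p ^ k = p ^ (k - r) * (sqrt p ^ r * sqrt p ^ r)"
    unfolding sq[OF assms(1)] using assms(4) by (simp flip: power_add)
  finally have 2: "p powr (real k - real r / 2) = p ^ (k - r) * sqrt p ^ r" using assms(1) by simp
  have 3: "sqrt (ln (real N) / (p * real N)) ^ r = sqrt (ln (real N)) ^ r / (sqrt p ^ r * sqrt (real N) ^ r)"
    by (simp add: real_sqrt_divide real_sqrt_mult power_divide power_mult_distrib)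
  have 4: "sqrt (real N) ^ r * sqrt (real N) ^ r = real N ^ r" by (rule sq[OF N(1)])
  have pos: "0 < sqrt p ^ r" "0 < sqrt (real N) ^ r" "0 < p ^ (k - r)" using assms N by simp_all
  show ?thesis unfolding 1 2 3 4[symmetric] using pos assms(2) by (simp add: field_simps)
qed

theorem theorem1p7:
  fixes k r :: nat
    and H :: "nat \<Rightarrow> nat set set"
    and \<eta> p \<delta> :: "nat \<Rightarrow> real"
  assumes "2 \<le> r" and "r \<le> k"
    and "\<forall>N. uniform_hypergraph k N (H N)"
    and "\<forall>N. 0 \<le> \<eta> N"
    and "\<forall>N. near_regular k (r - 1) (\<eta> N) N (H N)"
    and "\<forall>N. 0 \<le> p N \<and> p N \<le> 1"
    and "\<exists>c<1. \<forall>N. p N \<le> c"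
    and "\<forall>\<^sub>F N in sequentially. 0 < p N"
    and "\<forall>\<^sub>F N in sequentially. 0 < card (H N)"
    and "\<forall>\<^sub>F N in sequentially. 0 < \<delta> N"
    and "(\<lambda>N. Max {real (max_degree r N (H N)) * (real N * ln (real N)) powr (real r / 2)
                     / (p N powr (real k - real r / 2) * real (card (H N))),
                   (\<eta> N ^ r * p N ^ (k - r)) powr (1 / (real r - 1)),
                   1 / sqrt (p N * real N)}) \<lless> \<delta>"
    and "\<delta> \<lless> (\<lambda>N. (p N ^ (k - r) * real (card (H N))
                     / (real N ^ r * real (max_degree r N (H N)))) powr (1 / (real r - 1)))"
  shows "\<exists>\<epsilon> :: nat \<Rightarrow> real. \<epsilon> \<longlonglongrightarrow> 0 \<and>
           (\<forall>\<^sub>F N in sequentially.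
              measure_pmf.prob (random_subset N (p N))
                {B. \<bar>deviation k (H N) (p N) B\<bar> > \<delta> N * expected_edges N (H N) (p N)}
              = exp (- (1 + \<epsilon> N) * (\<delta> N ^ 2 * p N * real N / (2 * (real k)\<^sup>2 * (1 - p N)))))"
proof -
  note r = assms(1,2) and H = assms(3)[rule_format] and \<eta> = assms(4)[rule_format]
    and nr = assms(5)[rule_format] and p = assms(6)[rule_format]
    and p0 = assms(8) and h0 = assms(9) and d0 = assms(10)
  obtain c where c: "c < 1" "\<And>N. p N \<le> c" using assms(7) by blast
  define x where "x N = sqrt (ln (real N) / (p N * real N))" for N
  define Q where "Q N = p N ^ (k - r) * real (card (H N)) / (real N ^ r * real (max_degree r N (H N)))" for N
  let ?M1 = "\<lambda>N. real (max_degree r N (H N)) * (real N * ln (real N)) powr (real r / 2)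
                     / (p N powr (real k - real r / 2) * real (card (H N)))"
  let ?M2 = "\<lambda>N. (\<eta> N ^ r * p N ^ (k - r)) powr (1 / (real r - 1))"
  let ?M3 = "\<lambda>N. 1 / sqrt (p N * real N)"
  have Mlim: "(\<lambda>N. Max {?M1 N, ?M2 N, ?M3 N} / \<delta> N) \<longlonglongrightarrow> 0"
    using assms(11) by (simp only: much_less_def)
  have Qdlim: "(\<lambda>N. \<delta> N / Q N powr (1 / (real r - 1))) \<longlonglongrightarrow> 0"
    using assms(12) by (simp only: much_less_def Q_def)
  \<comment> \<open>Counting edges over r-sets gives h \<le> \<Delta> N^r. The resulting bound on Q
    is what lets the hypotheses force \<delta>, x and \<eta> to 0.\<close>
  have Q0: "\<forall>\<^sub>F N in sequentially. 0 < Q N \<and> Q N \<le> p N ^ (k - r)"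
    using p0 h0 eventually_ge_at_top[of k]
  proof eventually_elim
    case (elim N)
    have "card (H N) * 1 \<le> card (H N) * (k choose r)" 
      using zero_less_binomial[OF r(2)] by (intro mult_left_mono) linarith+
    also have "\<dots> \<le> max_degree r N (H N) * (N choose r)" by (rule card_edges_le_max_degree[OF H])
    also have "\<dots> \<le> max_degree r N (H N) * N ^ r"
      using elim r by (intro mult_left_mono binomial_le_pow) auto
    finally have le: "card (H N) \<le> max_degree r N (H N) * N ^ r" by simp
    then have pos: "0 < max_degree r N (H N)" "0 < N" using elim(2,3) r by (auto intro: gr0I)
    have "real (card (H N)) \<le> real N ^ r * real (max_degree r N (H N))"
      using le by (simp flip: of_nat_power of_nat_mult add: mult.commute)
    then have "real (card (H N)) / (real N ^ r * real (max_degree r N (H N))) \<le> 1" using pos by simp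
    then have "p N ^ (k - r) * (real (card (H N)) / (real N ^ r * real (max_degree r N (H N)))) \<le> p N ^ (k - r)"
      using elim(1) by (intro mult_left_le) auto
    then show ?case using elim pos by (simp add: Q_def)
  qed
  have Q1: "\<forall>\<^sub>F N in sequentially. 0 < Q N" using Q0 by eventually_elim simp
  have r1: "real r - 1 = real (r - 1)" "0 < r - 1" "0 < r" using r by (simp_all add: of_nat_diff)
  \<comment> \<open>The hypotheses contain (r - 1)-th roots; raising the quotients to the power r -
    1 removes them and keeps the limit 0.\<close>
  have root_power: "(a powr (1 / (real r - 1))) ^ (r - 1) = a" if "0 \<le> a" for a :: real
  proof (cases "a = 0")
    case False
    then have "(a powr (1 / real (r - 1))) ^ (r - 1) = a powr (real (r - 1) * (1 / real (r - 1)))"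
      using that by (simp add: powr_power mult.commute)
    also have "real (r - 1) * (1 / real (r - 1)) = 1" using r1(2) by simp
    finally show ?thesis unfolding r1(1) using that False by simp
  qed (use r1(2) in simp)

  have zero: "(0::real) ^ (r - 1) = 0" using r1(2) by simp
  have "(\<lambda>N. (\<delta> N / Q N powr (1 / (real r - 1))) ^ (r - 1)) \<longlonglongrightarrow> 0 ^ (r - 1)"
    by (intro tendsto_power Qdlim)
  moreover have "\<forall>\<^sub>F N in sequentially. (\<delta> N / Q N powr (1 / (real r - 1))) ^ (r - 1) = \<delta> N ^ (r - 1) / Q N"
    using Q1 by eventually_elim (simp add: power_divide root_power del: One_nat_def)
  ultimately have \<delta>Qlim: "(\<lambda>N. \<delta> N ^ (r - 1) / Q N) \<longlonglongrightarrow> 0"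
    unfolding zero by (rule Lim_transform_eventually)

  \<comment> \<open>As Q \<le> 1, dividing \<delta>^(r-1) by Q can only increase it.\<close>
  have \<delta>lim: "\<delta> \<longlonglongrightarrow> 0"
  proof (rule tendsto_zero_power_cancel[OF r1(2)])
    show "\<forall>\<^sub>F N in sequentially. 0 \<le> \<delta> N" using d0 by eventually_elim simp
    show "(\<lambda>N. \<delta> N ^ (r - 1)) \<longlonglongrightarrow> 0"
    proof (rule tendsto_sandwich[OF _ _ tendsto_const \<delta>Qlim])
      show "\<forall>\<^sub>F N in sequentially. 0 \<le> \<delta> N ^ (r - 1)" using d0 by eventually_elim simp
      show "\<forall>\<^sub>F N in sequentially. \<delta> N ^ (r - 1) \<le> \<delta> N ^ (r - 1) / Q N"
        using d0 Q0
      proof eventually_elim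
        case (elim N)
        have "p N ^ (k - r) \<le> 1" using p by (intro power_le_one) auto
        then have "Q N \<le> 1" using elim by linarith
        then show ?case using elim by (simp add: pos_le_divide_eq mult_left_le)
      qed
    qed
  qed

  have M1lim: "(\<lambda>N. x N ^ r / (Q N * \<delta> N)) \<longlonglongrightarrow> 0"
  proof -
    have "(\<lambda>N. ?M1 N / \<delta> N) \<longlonglongrightarrow> 0"
      by (rule quotient_tendsto_zero_le[OF Mlim d0]) (simp_all add: always_eventually)
    moreover have "\<forall>\<^sub>F N in sequentially. ?M1 N / \<delta> N = x N ^ r / (Q N * \<delta> N)"
      using p0 h0 eventually_ge_at_top[of 2]
    proof eventually_elim
      case (elim N)
      have "?M1 N = x N ^ r / Q N"
        unfolding x_def Q_def using elim r by (intro max_degree_term_eq) auto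
      then show ?case by simp
    qed
    ultimately show ?thesis by (rule Lim_transform_eventually)
  qed
  have M2lim: "(\<lambda>N. \<eta> N ^ r * p N ^ (k - r) / \<delta> N ^ (r - 1)) \<longlonglongrightarrow> 0"
  proof -
    have "(\<lambda>N. ?M2 N / \<delta> N) \<longlonglongrightarrow> 0"
      by (rule quotient_tendsto_zero_le[OF Mlim d0]) (simp_all add: always_eventually)
    then have "(\<lambda>N. (?M2 N / \<delta> N) ^ (r - 1)) \<longlonglongrightarrow> 0 ^ (r - 1)" by (rule tendsto_power)
    then show ?thesis unfolding zero using p \<eta> by (simp add: power_divide root_power del: One_nat_def)
  qed
  have \<Lambda>lim: "filterlim (\<lambda>N. \<delta> N ^ 2 * (p N * real N)) at_top sequentially"
  proof -
    have "(\<lambda>N. ?M3 N / \<delta> N) \<longlonglongrightarrow> 0"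
      by (rule quotient_tendsto_zero_le[OF Mlim d0]) (use p in \<open>simp_all add: always_eventually\<close>)
    then have "(\<lambda>N. (?M3 N / \<delta> N) ^ 2) \<longlonglongrightarrow> 0 ^ 2" by (rule tendsto_power)
    then have lim: "(\<lambda>N. (?M3 N / \<delta> N) ^ 2) \<longlonglongrightarrow> 0" by simp
    have "\<forall>\<^sub>F N in sequentially. 0 < (?M3 N / \<delta> N) ^ 2"
      using p0 d0 eventually_gt_at_top[of 0] by eventually_elim simp
    with lim have "filterlim (\<lambda>N. inverse ((?M3 N / \<delta> N) ^ 2)) at_top sequentially"
      by (rule filterlim_inverse_at_top)
    moreover have "inverse ((?M3 N / \<delta> N) ^ 2) = \<delta> N ^ 2 * (p N * real N)" for N
      using p[of N] by (simp add: power_divide power_mult_distrib)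
    ultimately show ?thesis by simp
  qed
  have x0: "\<forall>\<^sub>F N in sequentially. 0 \<le> x N"
    using p0 eventually_ge_at_top[of 1] by eventually_elim (simp add: x_def)
  have le1: "Q N \<le> 1" if "Q N \<le> p N ^ (k - r)" for N
    using that power_le_one[of "p N" "k - r"] p[of N] by linarith
  \<comment> \<open>Multiplying x^r / (Q \<delta>) by \<delta>, which tends to 0, leaves x^r / Q,
    and this dominates x^r because Q \<le> 1.\<close>
  have xlim: "x \<longlonglongrightarrow> 0"
  proof (rule tendsto_zero_power_cancel[OF r1(3) x0])
    have "(\<lambda>N. x N ^ r / (Q N * \<delta> N) * \<delta> N) \<longlonglongrightarrow> 0 * 0" by (intro tendsto_mult M1lim \<delta>lim)
    then have lim: "(\<lambda>N. x N ^ r / (Q N * \<delta> N) * \<delta> N) \<longlonglongrightarrow> 0" by simp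
    show "(\<lambda>N. x N ^ r) \<longlonglongrightarrow> 0"
    proof (rule tendsto_sandwich[OF _ _ tendsto_const lim])
      show "\<forall>\<^sub>F N in sequentially. 0 \<le> x N ^ r" using x0 by eventually_elim simp
      show "\<forall>\<^sub>F N in sequentially. x N ^ r \<le> x N ^ r / (Q N * \<delta> N) * \<delta> N"
        using x0 d0 Q0
      proof eventually_elim
        case (elim N)
        then show ?case using le1[of N] by (simp add: pos_le_divide_eq mult_left_le)
      qed
    qed
  qed
  \<comment> \<open>The factor \<open>Q / p ^ (k - r)\<close> is at most 1, so it can be inserted into products of the given limits.\<close>
  have \<eta>lim: "\<eta> \<longlonglongrightarrow> 0"
  proof (rule tendsto_zero_power_cancel[OF r1(3)])
    show "\<forall>\<^sub>F N in sequentially. 0 \<le> \<eta> N" using \<eta> by simp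
    have "(\<lambda>N. \<eta> N ^ r * p N ^ (k - r) / \<delta> N ^ (r - 1) * (\<delta> N ^ (r - 1) / Q N)) \<longlonglongrightarrow> 0 * 0"
      by (intro tendsto_mult M2lim \<delta>Qlim)
    then have lim: "(\<lambda>N. \<eta> N ^ r * p N ^ (k - r) / \<delta> N ^ (r - 1) * (\<delta> N ^ (r - 1) / Q N)) \<longlonglongrightarrow> 0" by simp
    show "(\<lambda>N. \<eta> N ^ r) \<longlonglongrightarrow> 0"
    proof (rule tendsto_sandwich[OF _ _ tendsto_const lim])
      show "\<forall>\<^sub>F N in sequentially. 0 \<le> \<eta> N ^ r" using \<eta> by simp
      show "\<forall>\<^sub>F N in sequentially. \<eta> N ^ r \<le> \<eta> N ^ r * p N ^ (k - r) / \<delta> N ^ (r - 1) * (\<delta> N ^ (r - 1) / Q N)"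
        using d0 Q0
      proof eventually_elim
        case (elim N)
        have "\<eta> N ^ r * Q N \<le> \<eta> N ^ r * p N ^ (k - r)" using elim \<eta>[of N] by (intro mult_left_mono) auto
        then show ?case using elim by (simp add: pos_le_divide_eq)
      qed
    qed
  qed
  have \<eta>xlim: "(\<lambda>N. \<eta> N * x N / \<delta> N) \<longlonglongrightarrow> 0"
  proof (rule tendsto_zero_power_cancel[OF r1(3)])
    show "\<forall>\<^sub>F N in sequentially. 0 \<le> \<eta> N * x N / \<delta> N"
      using x0 d0 by eventually_elim (simp add: \<eta>)
    \<comment> \<open>The powers of \<delta> add up to r: the product is (\<eta> x / \<delta>)^r
      times p^(k-r) / Q, a factor of at least 1.\<close>
    have "(\<lambda>N. \<eta> N ^ r * p N ^ (k - r) / \<delta> N ^ (r - 1) * (x N ^ r / (Q N * \<delta> N))) \<longlonglongrightarrow> 0 * 0"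
      by (intro tendsto_mult M2lim M1lim)
    then have lim: "(\<lambda>N. \<eta> N ^ r * p N ^ (k - r) / \<delta> N ^ (r - 1) * (x N ^ r / (Q N * \<delta> N))) \<longlonglongrightarrow> 0" by simp
    show "(\<lambda>N. (\<eta> N * x N / \<delta> N) ^ r) \<longlonglongrightarrow> 0"
    proof (rule tendsto_sandwich[OF _ _ tendsto_const lim])
      show "\<forall>\<^sub>F N in sequentially. 0 \<le> (\<eta> N * x N / \<delta> N) ^ r"
        using x0 d0 by eventually_elim (simp add: \<eta>)
      show "\<forall>\<^sub>F N in sequentially. (\<eta> N * x N / \<delta> N) ^ r
          \<le> \<eta> N ^ r * p N ^ (k - r) / \<delta> N ^ (r - 1) * (x N ^ r / (Q N * \<delta> N))"
        using x0 d0 Q0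
      proof eventually_elim
        case (elim N)
        define s where "s = \<eta> N ^ r * x N ^ r / \<delta> N ^ r"
        have s: "0 \<le> s" using elim \<eta>[of N] by (simp add: s_def)
        have "\<delta> N ^ r = \<delta> N ^ (r - 1) * \<delta> N" using r by (simp flip: power_Suc2)
        then have "\<eta> N ^ r * p N ^ (k - r) / \<delta> N ^ (r - 1) * (x N ^ r / (Q N * \<delta> N)) = s * (p N ^ (k - r) / Q N)"
          by (simp add: s_def mult_ac)
        moreover have "s * 1 \<le> s * (p N ^ (k - r) / Q N)" using elim s by (intro mult_left_mono) auto
        ultimately show ?case by (simp add: s_def power_mult_distrib power_divide)
      qed
    qed
  qed

  define L where "L N = p N ^ k * real (card (H N))" for N
  have L0: "\<forall>\<^sub>F N in sequentially. 0 < L N" using p0 h0 by eventually_elim (simp add: L_def)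
  have Lexp: "expected_edges N (H N) (p N) = L N" for N
    unfolding L_def using H p by (intro expected_edges_eq) auto
  have approx: "\<forall>\<^sub>F N in sequentially. measure_pmf.prob (random_subset N (p N))
       {B. \<bar>deviation k (H N) (p N) B - real k * L N / (p N * real N) * csum N (p N) B\<bar> > e * \<delta> N * L N}
        \<le> (2 * real r + 2) * exp (- (K * (\<delta> N ^ 2 * (p N * real N))))" if "0 < K" "0 < e" for K e
    unfolding L_def
    by (rule linear_approximation_eventually[OF H nr \<eta> r _ p0 h0 d0 x_def Q_def Q1 \<delta>lim \<Lambda>lim xlim \<eta>lim \<eta>xlim \<delta>Qlim M1lim that])
      (use p in auto)
  show ?thesis
    unfolding Lexp
  proof (rule exponent_from_sandwich)
    fix e :: real assume e: "0 < e"
    show "\<forall>\<^sub>F N in sequentially. 0 < \<delta> N ^ 2 * p N * real N / (2 * (real k)\<^sup>2 * (1 - p N)) \<and>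
       exp (- ((1 + e) * (\<delta> N ^ 2 * p N * real N / (2 * (real k)\<^sup>2 * (1 - p N)))))
         \<le> measure_pmf.prob (random_subset N (p N)) {B. \<bar>deviation k (H N) (p N) B\<bar> > \<delta> N * L N} \<and>
       measure_pmf.prob (random_subset N (p N)) {B. \<bar>deviation k (H N) (p N) B\<bar> > \<delta> N * L N}
         \<le> exp (- ((1 - e) * (\<delta> N ^ 2 * p N * real N / (2 * (real k)\<^sup>2 * (1 - p N)))))"
      by (rule moderate_deviation_sandwich[OF _ c _ _ p0 d0 L0 \<delta>lim \<Lambda>lim approx e]) (use r p in auto)
  qed
qed

end
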